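(* Let $k\ge 2$ and $j\in\{0,\dots,k-1\}$. Let $\lambda$ be a partition with empty $k$-core whose $k$-quotient $(\lambda^{(0)},\dots,\lambda^{(k-1)})$ satisfies $\lambda^{(j)}=\emptyset$. Let $\rho$ be the partition with empty $(k-1)$-core whose $(k-1)$-quotient is $(\lambda^{(0)},\dots,\lambda^{(j-1)},\lambda^{(j+1)},\dots,\lambda^{(k-1)})$. Then the map $\mathsf{Compress}$, which sends a $k$-ribbon tiling of (the Young diagram of) $\lambda$ to the collection of compressed tiles, is a well-defined bijection from the set of $k$-ribbon tilings of $\lambda$ to the set of $(k-1)$-ribbon tilings of $\rho$.
   Context: Square grid and Young diagrams (Russian notation). In the complex plane, a box is a closed square with vertices $(x\pm1)+yi$ and $x+(y\pm1)i$, where $x,y\in\mathbb Z$ and $x+y$ is odd. The Young diagram of a partition $\lambda=(\lambda_1\ge\lambda_2\ge\cdots)$ is the union of the boxes with centers $(r-c)+(r+c-1)i$ for $r\ge1$, $1\le c\le\lambda_r$; its lowest point is $0$. Partitions are identified with their Young diagrams. A ribbon is a union of boxes, connected through shared edges, no two of which have centers with the same real part; a $k$-ribbon is a ribbon with exactly $k$ boxes. A $k$-ribbon tiling of a region is an (unordered) decomposition of its boxes into $k$-ribbons. Abacus words. The northern border of $\lambda$, extended by the rays $\mathbb R_{\ge0}e^{3\pi i/4}$ and $\mathbb R_{\ge 0}e^{\pi i/4}$, is a bi-infinite path traversed from left to right by steps $1+i$ (up) and $1-i$ (down). Define $w_\lambda:\mathbb Z+\frac12\to\{\circ,\bullet\}$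 by letting $w_\lambda(\ell)=\circ$ if the step whose midpoint has real part $\ell$ is up and $w_\lambda(\ell)=\bullet$ if it is down. $k$-quotient, $k$-charges, and $k$-core. For $0\le r\le k-1$ there are a unique integer $c_r$ and a unique partition $\lambda^{(r)}$ such that $w_{\lambda^{(r)}}(\ell-c_r+\frac12)=w_\lambda(k\ell+r+\frac12)$ for all $\ell\in\mathbb Z$. The tuple $(\lambda^{(0)},\dots,\lambda^{(k-1)})$ is the $k$-quotient of $\lambda$, and $c_0,\dots,c_{k-1}$ are its $k$-charges. The $k$-core of $\lambda$ is the partition obtained from $\lambda$ by successively removing $k$-ribbons (each removal leaving the Young diagram of a partition) until this is no longer possible; it does not depend on the choices made. A partition is determined by its $k$-quotient and $k$-charges, and its $k$-core is empty if and only if all its $k$-charges are $0$. Compressed tiles. For $r\in\mathbb Z$ with $r\equiv j\pmod k$, the strip $\{z\in\mathbb C: r\le\operatorname{Re}(z)<r+1\}$ is called green. For $z$ in no green strip, let $m$ be the number of green strips lying between $z$ and the imaginary axis, i.e. the number of $r\equiv j\pmod k$ with $0\le r<\lfloor\operatorname{Re} z\rfloor$ if $\operatorname{Re}z\ge0$, and the number of $r\equiv j\pmod k$ with $\lfloor\operatorname{Re}z\rfloor<r<0$ if $\operatorname{Re}z<0$. Put $\phi(z)=z-m(1+i)$ if $\operatorname{Re} z\ge0$ (slide $m$ steps southwest) and $\phi(z)=z+m(1-i)$ if $\operatorname{Re}z<0$ (slide $m$ steps southeast). The compressed tile obtained from a tile $T$ is the closure of the image under $\phi$ of the part of the interior of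 $T$ that lies in no green strip. *)

theory Defs
  imports "HOL-Analysis.Analysis" "HOL-Library.Disjoint_Sets"
begin

subsection \<open>Boxes and ribbons\<close>

text \<open>A box is represented by its center \<open>x + y\<i>\<close>, stored as the pair \<open>(x, y)\<close> of
  integers; a union of boxes is then given by a set of such pairs.\<close>

definition cells :: "(int \<times> int) set" where
  "cells = {(x, y). odd (x + y)}"

definition box_at :: "int \<times> int \<Rightarrow> complex set" where
  "box_at p = (case p of (x, y) \<Rightarrow>
     convex hull {Complex (of_int (x - 1)) (of_int y), Complex (of_int (x + 1)) (of_int y),
                  Complex (of_int x) (of_int (y - 1)), Complex (of_int x) (of_int (y + 1))})"

definition region :: "(int \<times> int) set \<Rightarrow> complex set" where
  "region C = (\<Union>p\<in>C. box_at p)"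

text \<open>The four boxes sharing an edge with the box centered at \<open>(x, y)\<close> are those centered at
  \<open>(x \<plusminus> 1, y \<plusminus> 1)\<close>, with independent signs.\<close>

definition share_edge :: "int \<times> int \<Rightarrow> int \<times> int \<Rightarrow> bool" where
  "share_edge p q \<longleftrightarrow> \<bar>fst p - fst q\<bar> = 1 \<and> \<bar>snd p - snd q\<bar> = 1"

definition edge_connected :: "(int \<times> int) set \<Rightarrow> bool" where
  "edge_connected C \<longleftrightarrow>
     (\<forall>p\<in>C. \<forall>q\<in>C. (p, q) \<in> {(a, b). a \<in> C \<and> b \<in> C \<and> share_edge a b}\<^sup>*)"

definition is_ribbon :: "nat \<Rightarrow> (int \<times> int) set \<Rightarrow> bool" where
  "is_ribbon k R \<longleftrightarrow>
     R \<subseteq> cells \<and> finite R \<and> card R = k \<and> edge_connected R \<and> inj_on fst R"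

text \<open>A tiling is the set of its tiles, each tile being a subset of the complex plane.\<close>

definition ribbon_tilings :: "nat \<Rightarrow> (int \<times> int) set \<Rightarrow> complex set set set" where
  "ribbon_tilings k C = {region ` P | P. partition_on C P \<and> (\<forall>R\<in>P. is_ribbon k R)}"


subsection \<open>Partitions and Young diagrams\<close>

text \<open>The part \<open>\<lambda>\<^sub>r\<close> (\<open>r \<ge> 1\<close>) is the value at \<open>r - 1\<close>; parts are eventually \<open>0\<close>.\<close>

definition is_partition :: "(nat \<Rightarrow> nat) \<Rightarrow> bool" where
  "is_partition lam \<longleftrightarrow> antimono lam \<and> finite {i. lam i \<noteq> 0}"

definition empty_partition :: "nat \<Rightarrow> nat" where
  "empty_partition = (\<lambda>i. 0)"

definition diagram :: "(nat \<Rightarrow> nat) \<Rightarrow> (int \<times> int) set" where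
  "diagram lam = {(int r - int c, int r + int c - 1) | r c. 1 \<le> r \<and> 1 \<le> c \<and> c \<le> lam (r - 1)}"


subsection \<open>Abacus words\<close>

text \<open>The extended northern border is the graph of \<open>border_height lam\<close>: the Young diagram lies
  on or above the two rays \<open>y = \<bar>x\<bar>\<close>, so the supremum picks the top of the diagram where
  there is one and the ray elsewhere.\<close>

definition border_height :: "(nat \<Rightarrow> nat) \<Rightarrow> real \<Rightarrow> real" where
  "border_height lam x = Sup (insert \<bar>x\<bar> {Im z | z. z \<in> region (diagram lam) \<and> Re z = x})"

text \<open>\<open>Up\<close> and \<open>Down\<close> stand for the letters \<open>\<circ>\<close> and \<open>\<bullet>\<close>. The word is only meaningful, and
  only used, at arguments in \<open>\<int> + 1/2\<close>, where every step has slope \<open>1\<close> or \<open>-1\<close>.\<close>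

datatype step = Up | Down

definition abacus :: "(nat \<Rightarrow> nat) \<Rightarrow> real \<Rightarrow> step" where
  "abacus lam l =
     (if border_height lam (l + 1/2) = border_height lam (l - 1/2) + 1 then Up else Down)"


subsection \<open>Quotient, charges and core\<close>

definition quotient_and_charges ::
    "nat \<Rightarrow> (nat \<Rightarrow> nat) \<Rightarrow> (nat \<Rightarrow> nat \<Rightarrow> nat) \<Rightarrow> (nat \<Rightarrow> int) \<Rightarrow> bool" where
  "quotient_and_charges k lam Q c \<longleftrightarrow>
     (\<forall>r<k. is_partition (Q r) \<and>
        (\<forall>l::int. abacus (Q r) (of_int l - of_int (c r) + 1/2)
                = abacus lam (of_nat k * of_int l + of_nat r + 1/2)))"

text \<open>Only the values \<open>Q 0, \<dots>, Q (k - 1)\<close> matter.\<close>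

definition is_quotient :: "nat \<Rightarrow> (nat \<Rightarrow> nat) \<Rightarrow> (nat \<Rightarrow> nat \<Rightarrow> nat) \<Rightarrow> bool" where
  "is_quotient k lam Q \<longleftrightarrow> (\<exists>c. quotient_and_charges k lam Q c)"

definition ribbon_removal :: "nat \<Rightarrow> (nat \<Rightarrow> nat) \<Rightarrow> (nat \<Rightarrow> nat) \<Rightarrow> bool" where
  "ribbon_removal k lam mu \<longleftrightarrow>
     is_partition lam \<and> is_partition mu \<and>
     (\<exists>R. is_ribbon k R \<and> R \<subseteq> diagram lam \<and> diagram mu = diagram lam - R)"

definition is_core :: "nat \<Rightarrow> (nat \<Rightarrow> nat) \<Rightarrow> (nat \<Rightarrow> nat) \<Rightarrow> bool" where
  "is_core k lam mu \<longleftrightarrow>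
     (ribbon_removal k)\<^sup>*\<^sup>* lam mu \<and> \<not> (\<exists>nu. ribbon_removal k mu nu)"


subsection \<open>Compressed tiles\<close>

definition green :: "nat \<Rightarrow> nat \<Rightarrow> complex set" where
  "green k j = {z. \<exists>r::int. r mod int k = int j mod int k \<and> of_int r \<le> Re z \<and> Re z < of_int r + 1}"

definition green_between :: "nat \<Rightarrow> nat \<Rightarrow> complex \<Rightarrow> nat" where
  "green_between k j z =
     (if Re z \<ge> 0
      then card {r::int. r mod int k = int j mod int k \<and> 0 \<le> r \<and> r < \<lfloor>Re z\<rfloor>}
      else card {r::int. r mod int k = int j mod int k \<and> \<lfloor>Re z\<rfloor> < r \<and> r < 0})"

text \<open>The slide \<open>\<phi>\<close>; its values on green strips are irrelevant.\<close>

definition slide :: "nat \<Rightarrow> nat \<Rightarrow> complex \<Rightarrow> complex" where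
  "slide k j z =
     (if Re z \<ge> 0 then z - of_nat (green_between k j z) * (1 + \<i>)
      else z + of_nat (green_between k j z) * (1 - \<i>))"

definition compressed_tile :: "nat \<Rightarrow> nat \<Rightarrow> complex set \<Rightarrow> complex set" where
  "compressed_tile k j T = closure (slide k j ` (interior T - green k j))"

definition Compress :: "nat \<Rightarrow> nat \<Rightarrow> complex set set \<Rightarrow> complex set set" where
  "Compress k j t = compressed_tile k j ` t"

end

theory Submission
  imports Defs
begin

text \<open>The columns of a diagram, cut along the vertical lines through the integers, carry all the
  information. In column \<open>x\<close> the boxes lie consecutively above the ray \<open>\<bar>x\<bar>\<close>, so a diagram is the
  same as its sequence of column sizes, and one letter of the abacus word is one difference of
  neighbouring column sizes (\<open>column_size_diff\<close>). Emptiness of the core makes all charges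
  vanish (\<open>charge_eq_0\<close>): the boxes removed form \<open>k\<close>-ribbons, so the column differences in a fixed
  residue class telescope. Hence the runner \<open>j\<close>, whose quotient is empty, reads \<open>Down\<close> left of
  the origin and \<open>Up\<close> right of it; the two columns meeting in a green strip have the same size.
  Deleting the runner \<open>j\<close> from the word of \<open>\<lambda>\<close> gives the word of \<open>\<rho>\<close>, which says that \<open>\<rho>\<close> arises
  from \<open>\<lambda>\<close> by merging these pairs of equal columns (\<open>column_size_contract\<close>).

  The heart of the matter is that every tiling of \<open>\<lambda>\<close> respects these pairs. A tile through only one of
  the two columns of a green strip would start just right of the strip, or end just left of
  it. Since the columns have the same size, equally many tiles do the one and the other; but a tile
  ending at a green strip starts right after the previous green strip, so by induction from the far
  left there are no such tiles at all (\<open>tile_crosses_green\<close>). The tiles therefore match the boxes of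
  the two columns with adjacent boxes, and as one column begins one step above the other, the only
  matching is level by level (\<open>green_neighbours_same_tile\<close>).

  Merging paired boxes now shortens every tile by exactly one box, and the inverse splits the unique
  box of a \<open>(k - 1)\<close>-ribbon lying in a merged column. The
  slide \<open>\<phi>\<close> realises the merging geometrically: removing the green strip from two paired boxes and
  sliding the halves together gives the merged box (\<open>compressed_tile_region\<close>).\<close>

section \<open>Columns of a Young diagram\<close>

text \<open>The box at level \<open>i\<close> of column \<open>x\<close>, counted from the bottom of the quadrant above the two rays.
  In these coordinates a diagram is the region below the graph of its column sizes, and paired boxes
  on the two sides of a green strip have the same level.\<close>

definition cell :: "int \<Rightarrow> nat \<Rightarrow> int \<times> int" where
  "cell x i = (x, \<bar>x\<bar> + 1 + 2 * int i)"

definition column_size :: "(nat \<Rightarrow> nat) \<Rightarrow> int \<Rightarrow> nat" where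
  "column_size lam x = card {p \<in> diagram lam. fst p = x}"

lemma fst_cell [simp]: "fst (cell x i) = x"
  by (simp add: cell_def)

lemma cell_eq_iff [simp]: "cell x i = cell x' i' \<longleftrightarrow> x = x' \<and> i = i'"
  by (auto simp: cell_def)

lemma cell_in_cells: "cell x i \<in> cells"
  by (auto simp: cells_def cell_def abs_if)

lemma cell_in_diagram_iff:
  "cell x i \<in> diagram lam \<longleftrightarrow>
     (if x \<ge> 0 then i < lam (nat x + i) else nat (- x) + i < lam i)"
proof (cases "x \<ge> 0")
  case True
  have "cell x i \<in> diagram lam \<longleftrightarrow> i < lam (nat x + i)"
  proof
    assume "cell x i \<in> diagram lam"
    then obtain r c where rc: "x = int r - int c" "\<bar>x\<bar> + 1 + 2 * int i = int r + int c - 1"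
      "1 \<le> r" "1 \<le> c" "c \<le> lam (r - 1)"
      by (auto simp: diagram_def cell_def)
    then have "c = i + 1" "r - 1 = nat x + i" using True by linarith+
    then show "i < lam (nat x + i)" using rc(5) by simp
  next
    assume "i < lam (nat x + i)"
    moreover have "cell x i = (int (nat x + i + 1) - int (i + 1), int (nat x + i + 1) + int (i + 1) - 1)"
      using True by (simp add: cell_def)
    ultimately show "cell x i \<in> diagram lam"
      unfolding diagram_def
      by (intro CollectI exI[of _ "nat x + i + 1"] exI[of _ "i + 1"]) simp
  qed
  then show ?thesis using True by simp
next
  case False
  have "cell x i \<in> diagram lam \<longleftrightarrow> nat (- x) + i < lam i"
  proof
    assume "cell x i \<in> diagram lam"
    then obtain r c where rc: "x = int r - int c" "\<bar>x\<bar> + 1 + 2 * int i = int r + int c - 1"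
      "1 \<le> r" "1 \<le> c" "c \<le> lam (r - 1)"
      by (auto simp: diagram_def cell_def)
    then have "c = nat (- x) + i + 1" "r - 1 = i" using False by linarith+
    then show "nat (- x) + i < lam i" using rc(5) by simp
  next
    assume "nat (- x) + i < lam i"
    moreover have "cell x i = (int (i + 1) - int (nat (- x) + i + 1),
        int (i + 1) + int (nat (- x) + i + 1) - 1)"
      using False by (simp add: cell_def)
    ultimately show "cell x i \<in> diagram lam"
      unfolding diagram_def
      by (intro CollectI exI[of _ "i + 1"] exI[of _ "nat (- x) + i + 1"]) simp
  qed
  then show ?thesis using False by simp
qed

lemma diagram_memE:
  assumes "p \<in> diagram lam"
  obtains i where "p = cell (fst p) i"
proof -
  from assms obtain r c where rc: "p = (int r - int c, int r + int c - 1)" "1 \<le> r" "1 \<le> c"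
    by (auto simp: diagram_def)
  have "p = cell (fst p) (min r c - 1)"
    using rc by (auto simp: cell_def abs_if min_def)
  then show ?thesis using that by blast
qed

lemma diagram_column: "{p \<in> diagram lam. fst p = x} = cell x ` {i. cell x i \<in> diagram lam}"
proof
  show "{p \<in> diagram lam. fst p = x} \<subseteq> cell x ` {i. cell x i \<in> diagram lam}"
  proof
    fix p assume p: "p \<in> {p \<in> diagram lam. fst p = x}"
    then obtain i where "p = cell x i" using diagram_memE[of p lam] by blast
    then show "p \<in> cell x ` {i. cell x i \<in> diagram lam}" using p by blast
  qed
qed auto

lemma diagram_subset_cells: "diagram lam \<subseteq> cells"
  by (metis cell_in_cells diagram_memE subsetI)

lemma down_closed_eq_lessThan:
  fixes I :: "nat set"
  assumes "finite I" "\<And>i i'. i \<in> I \<Longrightarrow> i' \<le> i \<Longrightarrow> i' \<in> I"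
  shows "I = {..<card I}"
proof -
  define m where "m = (LEAST i. i \<notin> I)"
  have "\<exists>i. i \<notin> I" using assms(1) by (metis ex_new_if_finite infinite_UNIV_nat)
  then have "m \<notin> I" unfolding m_def by (rule LeastI_ex)
  moreover have "i \<in> I" if "i < m" for i
    using not_less_Least that unfolding m_def by blast
  ultimately have "I = {..<m}"
    using assms(2) by (metis lessThan_iff not_le subsetI subset_antisym)
  then show ?thesis by (metis card_lessThan)
qed

text \<open>Parts decrease, so the levels occupied in a column form an initial segment.\<close>

lemma cell_in_diagram:
  assumes "is_partition lam"
  shows "cell x i \<in> diagram lam \<longleftrightarrow> i < column_size lam x"
proof -
  have anti: "lam b \<le> lam a" if "a \<le> b" for a b
    using assms that by (auto simp: is_partition_def antimono_def)
  define I where "I = {i. cell x i \<in> diagram lam}"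
  have "i < lam 0" if "i \<in> I" for i
    using that anti[of 0 "nat x + i"] anti[of 0 i]
    by (auto simp: I_def cell_in_diagram_iff split: if_splits)
  then have "finite I" by (meson finite_nat_set_iff_bounded)
  moreover have "i' \<in> I" if "i \<in> I" "i' \<le> i" for i i'
    using that anti[of "nat x + i'" "nat x + i"] anti[of i' i]
    by (auto simp: I_def cell_in_diagram_iff split: if_splits)
  ultimately have "I = {..<card I}" by (rule down_closed_eq_lessThan)
  moreover have "column_size lam x = card I"
    by (simp add: column_size_def diagram_column I_def card_image inj_on_def)
  ultimately show ?thesis by (auto simp: I_def)
qed

lemma column_size_eventually_0:
  assumes "is_partition lam"
  shows "\<exists>N::int. \<forall>x. N \<le> \<bar>x\<bar> \<longrightarrow> column_size lam x = 0"
proof -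
  from assms have "finite {i. lam i \<noteq> 0}" by (simp add: is_partition_def)
  then obtain M where M: "\<And>i. lam i \<noteq> 0 \<Longrightarrow> i < M"
    by (meson finite_nat_set_iff_bounded mem_Collect_eq)
  have "column_size lam x = 0" if "int (M + lam 0) \<le> \<bar>x\<bar>" for x
  proof -
    have "x \<ge> 0 \<Longrightarrow> lam (nat x) = 0"
      using that M[of "nat x"] by linarith
    then have "cell x 0 \<notin> diagram lam"
      using that by (auto simp: cell_in_diagram_iff)
    then show ?thesis using cell_in_diagram[OF assms] by simp
  qed
  then show ?thesis by blast
qed

lemma finite_column:
  assumes "is_partition lam"
  shows "finite {p \<in> diagram lam. fst p = x}"
  unfolding diagram_column using cell_in_diagram[OF assms] by simp

lemma column_size_step_nonneg:
  assumes "is_partition lam" "x \<ge> 0"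
  shows "column_size lam (x + 1) \<le> column_size lam x"
    and "column_size lam x \<le> column_size lam (x + 1) + 1"
proof -
  have anti: "lam b \<le> lam a" if "a \<le> b" for a b
    using assms that by (auto simp: is_partition_def antimono_def)
  have *: "i < column_size lam x" if "i < column_size lam (x + 1)" for i
    using that anti[of "nat x + i" "nat (x + 1) + i"] assms(2)
    by (auto simp flip: cell_in_diagram[OF assms(1)] simp: cell_in_diagram_iff nat_mono
        split: if_splits)
  show "column_size lam (x + 1) \<le> column_size lam x"
    using * by (meson le_refl not_le)
  have **: "i < column_size lam (x + 1)" if "Suc i < column_size lam x" for i
  proof -
    have "nat (x + 1) + i = nat x + Suc i" using assms(2) by simp
    then show ?thesis using that assms(2)
      by (auto simp flip: cell_in_diagram[OF assms(1)] simp: cell_in_diagram_iff split: if_splits)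
  qed
  show "column_size lam x \<le> column_size lam (x + 1) + 1"
    using **[of "column_size lam (x + 1)"] by linarith
qed

lemma column_size_step_neg:
  assumes "is_partition lam" "x < 0"
  shows "column_size lam x \<le> column_size lam (x + 1)"
    and "column_size lam (x + 1) \<le> column_size lam x + 1"
proof -
  have anti: "lam b \<le> lam a" if "a \<le> b" for a b
    using assms that by (auto simp: is_partition_def antimono_def)
  have *: "i < column_size lam (x + 1)" if "i < column_size lam x" for i
    using that assms(2)
    by (auto simp flip: cell_in_diagram[OF assms(1)] simp: cell_in_diagram_iff split: if_splits)
  show "column_size lam x \<le> column_size lam (x + 1)"
    using * by (meson le_refl not_le)
  have **: "i < column_size lam x" if "Suc i < column_size lam (x + 1)" for i
    using that anti[of i "Suc i"] assms(2)
    by (auto simp flip: cell_in_diagram[OF assms(1)] simp: cell_in_diagram_iff split: if_splits)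
  show "column_size lam (x + 1) \<le> column_size lam x + 1"
    using **[of "column_size lam x"] by linarith
qed

section \<open>Border and abacus word in terms of column sizes\<close>

text \<open>Boxes are the unit balls of the 1-norm, which turns membership in a box into linear arithmetic.\<close>

lemma box_at_eq:
  "box_at p = {z. \<bar>Re z - of_int (fst p)\<bar> + \<bar>Im z - of_int (snd p)\<bar> \<le> 1}"
proof -
  obtain x y where p: "p = (x, y)" by (cases p)
  let ?V = "{Complex (of_int (x - 1)) (of_int y), Complex (of_int (x + 1)) (of_int y),
             Complex (of_int x) (of_int (y - 1)), Complex (of_int x) (of_int (y + 1))}"
  let ?B = "{z. \<bar>Re z - of_int x\<bar> + \<bar>Im z - of_int y\<bar> \<le> 1}"
  have "convex ?B"
  proof (rule convexI)
    fix z w :: complex and u v :: real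
    assume zw: "z \<in> ?B" "w \<in> ?B" and uv: "0 \<le> u" "0 \<le> v" "u + v = 1"
    have lin: "\<bar>u * s + v * t - c\<bar> \<le> u * \<bar>s - c\<bar> + v * \<bar>t - c\<bar>" for s t c :: real
    proof -
      have "u * (s - c) + v * (t - c) = u * s + v * t - (u + v) * c"
        by (simp add: algebra_simps)
      then have "\<bar>u * s + v * t - c\<bar> = \<bar>u * (s - c) + v * (t - c)\<bar>"
        using uv(3) by simp
      also have "\<dots> \<le> \<bar>u * (s - c)\<bar> + \<bar>v * (t - c)\<bar>" by simp
      finally show ?thesis using uv by (simp add: abs_mult)
    qed
    have "\<bar>u * Re z + v * Re w - of_int x\<bar> + \<bar>u * Im z + v * Im w - of_int y\<bar>
       \<le> u * (\<bar>Re z - of_int x\<bar> + \<bar>Im z - of_int y\<bar>) + v * (\<bar>Re w - of_int x\<bar> + \<bar>Im w - of_int y\<bar>)"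
      using lin[of "Re z" "Re w" "of_int x"] lin[of "Im z" "Im w" "of_int y"] by (simp add: algebra_simps)
    also have "\<dots> \<le> u * 1 + v * 1"
      using zw uv by (intro add_mono mult_left_mono) auto
    finally show "u *\<^sub>R z + v *\<^sub>R w \<in> ?B" using uv by simp
  qed
  then have "convex hull ?V \<subseteq> ?B" by (intro hull_minimal) auto
  moreover have "z \<in> convex hull ?V" if "z \<in> ?B" for z
  proof -
    define u v where "u = Re z - of_int x" and "v = Im z - of_int y"
    define s where "s = (1 - \<bar>u\<bar> - \<bar>v\<bar>) / 4"
    have s: "s \<ge> 0" using that by (simp add: s_def u_def v_def)
    \<comment> \<open>The weights of the four corners: the coordinates of \<open>z\<close> relative to the center, distributed by sign,
      plus the slack \<open>s\<close> shared equally, which cancels between opposite corners.\<close>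
    define a where "a i = (if i = 0 then max (- u) 0 else if i = 1 then max u 0
        else if i = 2 then max (- v) 0 else max v 0) + s" for i :: nat
    define P where "P i = (if i = 0 then Complex (of_int (x - 1)) (of_int y)
        else if i = 1 then Complex (of_int (x + 1)) (of_int y)
        else if i = 2 then Complex (of_int x) (of_int (y - 1))
        else Complex (of_int x) (of_int (y + 1)))" for i :: nat
    have sum4: "sum f {0, 1, 2, 3::nat} = f 0 + f 1 + f 2 + f 3" for f :: "nat \<Rightarrow> 'c :: ab_group_add"
      by (simp add: add.assoc)
    have total: "max (- u) 0 + max u 0 + max (- v) 0 + max v 0 + 4 * s = 1"
      by (simp add: s_def max_def abs_if field_simps)
    have "(\<Sum>i\<in>{0, 1, 2, 3}. a i *\<^sub>R P i) \<in> convex hull ?V"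
    proof (rule convex_sum)
      show "(\<Sum>i\<in>{0, 1, 2, 3}. a i) = 1" using total by (simp add: sum4 a_def)
      show "0 \<le> a i" for i using s by (simp add: a_def)
      show "P i \<in> convex hull ?V" for i by (rule hull_inc) (simp add: P_def)
    qed (auto simp: convex_convex_hull)
    moreover have "(\<Sum>i\<in>{0, 1, 2, 3}. a i *\<^sub>R P i) = z"
    proof (rule complex_eqI)
      have "Re (\<Sum>i\<in>{0, 1, 2, 3}. a i *\<^sub>R P i)
          = (max (- u) 0 + max u 0 + max (- v) 0 + max v 0 + 4 * s) * of_int x + (max u 0 - max (- u) 0)"
        by (simp add: sum4 a_def P_def algebra_simps)
      then show "Re (\<Sum>i\<in>{0, 1, 2, 3}. a i *\<^sub>R P i) = Re z"
        unfolding total by (simp add: u_def max_def)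
      have "Im (\<Sum>i\<in>{0, 1, 2, 3}. a i *\<^sub>R P i)
          = (max (- u) 0 + max u 0 + max (- v) 0 + max v 0 + 4 * s) * of_int y + (max v 0 - max (- v) 0)"
        by (simp add: sum4 a_def P_def algebra_simps)
      then show "Im (\<Sum>i\<in>{0, 1, 2, 3}. a i *\<^sub>R P i) = Im z"
        unfolding total by (simp add: v_def max_def)
    qed
    ultimately show ?thesis by simp
  qed
  ultimately show ?thesis by (auto simp: p box_at_def)
qed

text \<open>Over an integer \<open>x\<close> the diagram also contains the side corners of boxes in the columns
  \<open>x - 1\<close> and \<open>x + 1\<close>; since neighbouring border heights differ by at most \<open>1\<close>, these corners do not
  exceed the top of column \<open>x\<close>.\<close>

lemma border_height_of_int:
  assumes "is_partition lam"
  shows "border_height lam (of_int x) = of_int (\<bar>x\<bar> + 2 * int (column_size lam x))"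
proof -
  let ?h = "\<lambda>x. \<bar>x\<bar> + 2 * int (column_size lam x)"
  let ?S = "insert \<bar>of_int x :: real\<bar> {Im z | z. z \<in> region (diagram lam) \<and> Re z = of_int x}"
  have step: "?h (t + 1) \<le> ?h t + 1" "?h t \<le> ?h (t + 1) + 1" for t
    using column_size_step_nonneg[OF assms, of t] column_size_step_neg[OF assms, of t]
    by (auto simp: abs_if)
  have "s \<le> of_int (?h x)" if "s \<in> ?S" for s
  proof (cases "s = \<bar>of_int x\<bar>")
    case False
    with that obtain z p where z: "s = Im z" "z \<in> box_at p" "p \<in> diagram lam" "Re z = of_int x"
      by (auto simp: region_def)
    obtain i where i: "p = cell (fst p) i" using diagram_memE z(3) by blast
    define a where "a = fst p"
    have ia: "i < column_size lam a" using cell_in_diagram[OF assms] i z(3) a_def by metis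
    have box: "\<bar>of_int x - of_int a\<bar> + \<bar>Im z - of_int (\<bar>a\<bar> + 1 + 2 * int i)\<bar> \<le> (1::real)"
    proof -
      have "snd p = \<bar>a\<bar> + 1 + 2 * int i" using i by (metis a_def cell_def snd_conv)
      then show ?thesis using z(2,4) by (simp add: box_at_eq a_def)
    qed
    then have "Im z \<le> of_int (\<bar>a\<bar> + 1 + 2 * int i + 1 - \<bar>x - a\<bar>)" by simp
    also have "\<dots> \<le> of_int (?h x)"
    proof -
      have "real_of_int \<bar>x - a\<bar> \<le> 1" using box by simp
      then have "\<bar>x - a\<bar> \<le> 1" by linarith
      then consider "a = x" | "a = x + 1" | "x = a + 1" by linarith
      then have "\<bar>a\<bar> + 1 + 2 * int i + 1 - \<bar>x - a\<bar> \<le> ?h x"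
      proof cases
        case 1 then show ?thesis using ia by simp
      next
        case 2 then show ?thesis using ia step(1)[of x] by simp
      next
        case 3 then show ?thesis using ia step(2)[of a] by simp
      qed
      then show ?thesis by (simp only: of_int_le_iff)
    qed
    finally show ?thesis using z(1) by simp
  qed simp
  moreover have "of_int (?h x) \<in> ?S"
  proof (cases "column_size lam x = 0")
    case False
    let ?c = "cell x (column_size lam x - 1)"
    have "?c \<in> diagram lam" using cell_in_diagram[OF assms] False by simp
    moreover have "Complex (of_int x) (of_int (?h x)) \<in> box_at ?c"
      using False by (simp add: box_at_eq cell_def of_nat_diff)
    ultimately have "Complex (of_int x) (of_int (?h x)) \<in> region (diagram lam)"
      unfolding region_def by blast
    then show ?thesis by force
  qed simp
  ultimately show ?thesis
    unfolding border_height_def by (intro cSup_eq_maximum)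
qed

definition up :: "(nat \<Rightarrow> nat) \<Rightarrow> int \<Rightarrow> bool" where
  "up lam x \<longleftrightarrow> abacus lam (of_int x + 1 / 2) = Up"

text \<open>The subtracted term is the slope contribution of the ray \<open>\<bar>x\<bar>\<close>, that is, the word of the empty
  partition.\<close>

lemma column_size_diff:
  assumes "is_partition lam"
  shows "int (column_size lam (x + 1)) - int (column_size lam x) = of_bool (up lam x) - of_bool (x \<ge> 0)"
proof -
  have "border_height lam (of_int x + 1/2 + 1/2) = border_height lam (of_int (x + 1))"
    by (simp add: add.commute)
  moreover have "border_height lam (of_int x + 1/2 - 1/2) = border_height lam (of_int x)"
    by simp
  ultimately have "up lam x \<longleftrightarrow> border_height lam (of_int (x + 1)) = border_height lam (of_int x) + 1"
    by (simp add: up_def abacus_def)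
  also have "\<dots> \<longleftrightarrow> \<bar>x + 1\<bar> + 2 * int (column_size lam (x + 1)) = \<bar>x\<bar> + 2 * int (column_size lam x) + 1"
    unfolding border_height_of_int[OF assms] by linarith
  finally show ?thesis
    using column_size_step_nonneg[OF assms, of x] column_size_step_neg[OF assms, of x]
    by (auto simp: abs_if split: if_splits)
qed

lemma abacus_eq_iff_up:
  "abacus lam (of_int x + 1 / 2) = abacus mu (of_int y + 1 / 2) \<longleftrightarrow> up lam x = up mu y"
  unfolding up_def by (metis step.exhaust)

section \<open>Removing the green strips from the line\<close>

text \<open>The position of the grid line \<open>Re z = x\<close> after the green strips have been deleted: \<open>x\<close> minus the signed
  number of green strips between \<open>0\<close> and \<open>x\<close>. The two sides of a green strip are identified.\<close>

definition contract :: "nat \<Rightarrow> nat \<Rightarrow> int \<Rightarrow> int" where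
  "contract k j x = x - 1 - (x - int j - 1) div int k"

text \<open>Boxes keep their level above the ray (\<open>contract_cell_cell\<close> below).\<close>

definition contract_cell :: "nat \<Rightarrow> nat \<Rightarrow> int \<times> int \<Rightarrow> int \<times> int" where
  "contract_cell k j p =
     (contract k j (fst p), snd p + \<bar>contract k j (fst p)\<bar> - \<bar>fst p\<bar>)"

lemma fst_contract_cell [simp]: "fst (contract_cell k j p) = contract k j (fst p)"
  by (simp add: contract_cell_def)

lemma contract_cell_cell [simp]: "contract_cell k j (cell x i) = cell (contract k j x) i"
  by (simp add: contract_cell_def cell_def)

lemma contract_eq:
  assumes "r < k" "j < k"
  shows "contract k j (int k * l + int r) = (int k - 1) * l + int r - of_bool (j < r)"
proof -
  have "(int k * l + int r - int j - 1) div int k = l + (int r - int j - 1) div int k"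
  proof -
    have "int k * l + int r - int j - 1 = (int r - int j - 1) + int k * l" by simp
    then show ?thesis using assms by (simp only: div_mult_self2)
  qed
  moreover have "(int r - int j - 1) div int k = (if j < r then 0 else - 1)"
  proof (cases "j < r")
    case True
    then show ?thesis using assms by (simp add: div_pos_pos_trivial)
  next
    case False
    have "(int r - int j - 1) div int k = - 1"
      by (rule int_div_pos_eq[where r = "int k + int r - int j - 1"]) (use assms False in auto)
    then show ?thesis using False by simp
  qed
  ultimately show ?thesis by (simp add: contract_def algebra_simps)
qed

context
  fixes k j :: nat
  assumes k2: "2 \<le> k" and jk: "j < k"
begin

lemma residueE:
  obtains l r where "x = int k * l + int r" "r < k" "x mod int k = int r"
proof
  show "x = int k * (x div int k) + int (nat (x mod int k))"
    "nat (x mod int k) < k" "x mod int k = int (nat (x mod int k))"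
    using k2 by (auto simp: nat_less_iff)
qed

lemma contract_step:
  "contract k j (x + 1) = contract k j x + (if x mod int k = int j then 0 else 1)"
proof -
  obtain l r where x: "x = int k * l + int r" "r < k" "x mod int k = int r"
    by (rule residueE)
  show ?thesis
  proof (cases "Suc r < k")
    case True
    have "x + 1 = int k * l + int (Suc r)" using x by simp
    then have "contract k j (x + 1) = (int k - 1) * l + int (Suc r) - of_bool (j < Suc r)"
      using contract_eq[OF True jk, of l] by (simp only:)
    moreover have "contract k j x = (int k - 1) * l + int r - of_bool (j < r)"
      using contract_eq[OF x(2) jk, of l] x(1) by simp
    ultimately show ?thesis using x(3) by auto
  next
    case False
    then have r: "int k = int r + 1" using x(2) by simp
    have "x + 1 = int k * (l + 1) + int 0" using x(1) r by (simp add: algebra_simps)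
    then have "contract k j (x + 1) = (int k - 1) * (l + 1)"
      using contract_eq[of 0 k j "l + 1"] k2 jk by simp
    moreover have "contract k j x = (int k - 1) * l + int r - of_bool (j < r)"
      using contract_eq[OF x(2) jk, of l] x(1) by simp
    moreover have "j < r \<longleftrightarrow> r \<noteq> j" using False x(2) jk by auto
    ultimately show ?thesis using x(3) r by (auto simp: algebra_simps)
  qed
qed

lemma contract_0 [simp]: "contract k j 0 = 0"
  using contract_eq[of 0 k j 0] k2 jk by simp

lemma contract_mono: "x \<le> y \<Longrightarrow> contract k j x \<le> contract k j y"
proof (induction y rule: int_ge_induct)
  case (step y)
  then show ?case using contract_step[of y] by (auto split: if_splits)
qed simp

lemma contract_add_period: "contract k j (x + int k) = contract k j x + int k - 1"
proof -
  have "(x + int k - int j - 1) div int k = (x - int j - 1 + int k) div int k"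
    by (simp add: algebra_simps)
  also have "\<dots> = (x - int j - 1) div int k + 1"
    using k2 by (intro div_add_self2) simp
  finally show ?thesis by (simp add: contract_def)
qed

lemma contract_surj: "\<exists>x. contract k j x = v"
proof -
  define l s where "l = v div (int k - 1)" and "s = nat (v mod (int k - 1))"
  have v: "v = (int k - 1) * l + int s" "s < k - 1"
    using k2 by (auto simp: l_def s_def nat_less_iff of_nat_diff)
  show ?thesis
  proof (cases "j < s + 1")
    case True
    then show ?thesis using contract_eq[of "s + 1" k j l] v jk
      by (intro exI[of _ "int k * l + int (s + 1)"]) simp
  next
    case False
    then show ?thesis using contract_eq[of s k j l] v jk
      by (intro exI[of _ "int k * l + int s"]) simp
  qed
qed

lemma contract_nonneg: "x \<ge> 0 \<Longrightarrow> contract k j x \<ge> 0"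
  using contract_mono[of 0 x] by simp

lemma contract_nonpos: "x \<le> 0 \<Longrightarrow> contract k j x \<le> 0"
  using contract_mono[of x 0] by simp

lemma green_Suc: "x mod int k = int j \<Longrightarrow> (x + 1) mod int k \<noteq> int j"
proof
  assume "x mod int k = int j" "(x + 1) mod int k = int j"
  then have "int k dvd (x + 1) - x" by (metis mod_eq_dvd_iff)
  then show False using k2 by simp
qed

lemma contract_eq_cases:
  assumes "contract k j x = contract k j y" "x < y"
  shows "y = x + 1 \<and> x mod int k = int j"
proof -
  have x: "x mod int k = int j"
    using contract_mono[of "x + 1" y] contract_step[of x] assms by (auto split: if_splits)
  have "contract k j (x + 1 + 1) = contract k j x + 1"
    using contract_step[of "x + 1"] contract_step[of x] green_Suc[OF x] x by simp
  then have "\<not> x + 1 + 1 \<le> y"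
    using contract_mono[of "x + 1 + 1" y] assms by linarith
  then show ?thesis using x assms by simp
qed

lemma abs_contract_step:
  assumes "x mod int k \<noteq> int j"
  shows "\<bar>contract k j (x + 1)\<bar> - \<bar>x + 1\<bar> = \<bar>contract k j x\<bar> - \<bar>x\<bar>"
proof -
  have step: "contract k j (x + 1) = contract k j x + 1" using contract_step[of x] assms by simp
  show ?thesis
  proof (cases "x \<ge> 0")
    case True
    then show ?thesis using step contract_nonneg[of x] by simp
  next
    case False
    then show ?thesis using step contract_nonpos[of "x + 1"] by simp
  qed
qed

text \<open>The vertical part of the slide is southwards on either side, whereas its horizontal part is
  directed towards the origin.\<close>

lemma abs_contract:
  "\<bar>contract k j x\<bar> - \<bar>x\<bar> = (if x \<ge> 0 then contract k j x - x else x - contract k j x)"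
  using contract_nonneg[of x] contract_nonpos[of x] by auto

text \<open>A window of \<open>k - 1\<close> contracted columns contains exactly one merged column, so it comes from a
  window of \<open>k\<close> columns; this is why ribbons lose exactly one box.\<close>

lemma contract_interval:
  assumes "(x - 1) mod int k \<noteq> int j"
  shows "contract k j y \<in> {contract k j x..<contract k j x + (int k - 1)} \<longleftrightarrow> y \<in> {x..<x + int k}"
proof -
  have before: "contract k j (x - 1) = contract k j x - 1"
    using contract_step[of "x - 1"] assms by simp
  have after: "contract k j (x - 1 + int k) = contract k j x + int k - 2"
    using before contract_add_period[of "x - 1"] by simp
  consider "y \<le> x - 1" | "x \<le> y" "y \<le> x - 1 + int k" | "x + int k \<le> y" by linarith
  then show ?thesis
  proof cases
    case 1
    then show ?thesis using contract_mono[OF 1] before by simp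
  next
    case 2
    then show ?thesis using contract_mono[OF 2(1)] contract_mono[OF 2(2)] after by simp
  next
    case 3
    then show ?thesis using contract_mono[OF 3] contract_add_period[of x] by simp
  qed
qed

lemma contract_interval_start:
  obtains x where "contract k j x = v" "(x - 1) mod int k \<noteq> int j"
proof -
  obtain x where x: "contract k j x = v" using contract_surj by blast
  show ?thesis
  proof (cases "(x - 1) mod int k = int j")
    case True
    then have "contract k j (x - 1) = v" using x contract_step[of "x - 1"] by simp
    moreover have "(x - 1 - 1) mod int k \<noteq> int j" using green_Suc[of "x - 1 - 1"] True by auto
    ultimately show ?thesis using that by blast
  next
    case False
    then show ?thesis using that x by blast
  qed
qed

lemma green_between_of_floor:
  assumes "\<lfloor>Re z\<rfloor> = x" "x mod int k \<noteq> int j"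
  shows "int (green_between k j z) = (if x \<ge> 0 then x - contract k j x else contract k j x - x)"
proof -
  have jm: "int j mod int k = int j" using jk by simp
  \<comment> \<open>Each green strip adds one to the count and makes the contraction stall for one step.\<close>
  have pos: "int (card {r. r mod int k = int j \<and> 0 \<le> r \<and> r < x}) = x - contract k j x" if "x \<ge> 0" for x
    using that
  proof (induction x rule: int_ge_induct)
    case base
    then show ?case by simp
  next
    case (step x)
    let ?A = "{r. r mod int k = int j \<and> 0 \<le> r \<and> r < x}"
    have "{r. r mod int k = int j \<and> 0 \<le> r \<and> r < x + 1} = (if x mod int k = int j then insert x ?A else ?A)"
      using step(1) by (auto simp: less_le)
    moreover have "finite ?A" by (rule finite_subset[of _ "{0..<x}"]) auto
    moreover have "x \<notin> ?A" by simp
    ultimately show ?case using step contract_step[of x] by auto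
  qed
  have neg: "int (card {r. r mod int k = int j \<and> x \<le> r \<and> r < 0}) = contract k j x - x" if "x \<le> 0" for x
    using that
  proof (induction x rule: int_le_induct)
    case base
    then show ?case by simp
  next
    case (step x)
    let ?A = "{r. r mod int k = int j \<and> x \<le> r \<and> r < 0}"
    have "{r. r mod int k = int j \<and> x - 1 \<le> r \<and> r < 0}
        = (if (x - 1) mod int k = int j then insert (x - 1) ?A else ?A)"
    proof -
      have "x - 1 \<le> r \<longleftrightarrow> r = x - 1 \<or> x \<le> r" for r by linarith
      then show ?thesis using step(1) by auto
    qed
    moreover have "finite ?A" by (rule finite_subset[of _ "{x..<0}"]) auto
    moreover have "x - 1 \<notin> ?A" by simp
    ultimately show ?case using step contract_step[of "x - 1"] by auto
  qed
  have "Re z \<ge> 0 \<longleftrightarrow> x \<ge> 0" using assms(1) by linarith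
  moreover have "{r. r mod int k = int j \<and> x < r \<and> r < 0} = {r. r mod int k = int j \<and> x \<le> r \<and> r < 0}"
    using assms(2) by (auto simp: less_le)
  ultimately show ?thesis
    using pos[of x] neg[of x] assms(1) by (simp add: green_between_def jm)
qed

lemma slide_eq:
  assumes "\<lfloor>Re z\<rfloor> = x" "x mod int k \<noteq> int j"
  shows "slide k j z = z + Complex (of_int (contract k j x - x)) (of_int (\<bar>contract k j x\<bar> - \<bar>x\<bar>))"
proof -
  have sgn: "Re z \<ge> 0 \<longleftrightarrow> x \<ge> 0" using assms(1) by linarith
  have "real (green_between k j z) = of_int (if x \<ge> 0 then x - contract k j x else contract k j x - x)"
    using green_between_of_floor[OF assms] by (metis of_int_of_nat_eq)
  then show ?thesis
    unfolding abs_contract by (simp add: slide_def sgn complex_eq_iff)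
qed

lemma green_iff: "z \<in> green k j \<longleftrightarrow> \<lfloor>Re z\<rfloor> mod int k = int j"
proof -
  have "of_int r \<le> Re z \<and> Re z < of_int r + 1 \<longleftrightarrow> \<lfloor>Re z\<rfloor> = r" for r
    by (simp add: floor_eq_iff)
  then show ?thesis using jk by (simp add: green_def)
qed

end

section \<open>Ribbons\<close>

text \<open>The columns of adjacent boxes differ by one, so a path of boxes cannot jump over a grid line.
  With at most one box per column this determines the shape of a ribbon completely.\<close>

lemma edge_connected_crossing:
  assumes "edge_connected R" "p \<in> R" "q \<in> R" "fst p \<le> x" "x < fst q"
  shows "\<exists>a\<in>R. \<exists>b\<in>R. fst a = x \<and> fst b = x + 1 \<and> share_edge a b"
proof -
  have "(p, q) \<in> {(a, b). a \<in> R \<and> b \<in> R \<and> share_edge a b}\<^sup>*"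
    using assms by (simp add: edge_connected_def)
  then have "x < fst q \<longrightarrow> ?thesis"
  proof (induction rule: rtrancl_induct)
    case base
    then show ?case using assms(4) by simp
  next
    case (step b c)
    show ?case
    proof (cases "x < fst b")
      case False
      then have "x < fst c \<longrightarrow> fst b = x \<and> fst c = x + 1"
        using step(2) by (auto simp: share_edge_def)
      then show ?thesis using step(2) by blast
    qed (use step in blast)
  qed
  then show ?thesis using assms(5) by blast
qed

lemma ribbon_columns:
  assumes "is_ribbon k R" "1 \<le> k"
  obtains x where "fst ` R = {x..<x + int k}"
proof -
  have R: "finite R" "card (fst ` R) = k" "edge_connected R"
    using assms(1) by (auto simp: is_ribbon_def card_image)
  let ?C = "fst ` R"
  have ne: "finite ?C" "?C \<noteq> {}" using R assms(2) by auto
  have "?C = {Min ?C..Max ?C}"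
  proof
    show "?C \<subseteq> {Min ?C..Max ?C}" using Min_le[OF ne(1)] Max_ge[OF ne(1)] by (meson atLeastAtMost_iff subsetI)
    show "{Min ?C..Max ?C} \<subseteq> ?C"
    proof
      fix x assume x: "x \<in> {Min ?C..Max ?C}"
      obtain p q where pq: "p \<in> R" "fst p = Min ?C" "q \<in> R" "fst q = Max ?C"
        using Min_in[OF ne] Max_in[OF ne] by (metis imageE)
      show "x \<in> ?C"
      proof (cases "x = Max ?C")
        case True
        then show ?thesis using pq by force
      next
        case False
        then show ?thesis
          using edge_connected_crossing[OF R(3) pq(1,3), of x] x pq by force
      qed
    qed
  qed
  moreover from this have "k = nat (Max ?C - Min ?C + 1)"
    using R(2) card_atLeastAtMost_int by metis
  then have "Max ?C + 1 = Min ?C + int k" using assms(2) by simp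
  ultimately have "?C = {Min ?C..<Min ?C + int k}" 
    by (metis atLeastLessThanPlusOne_atLeastAtMost_int)
  then show ?thesis using that by blast
qed

lemma ribbon_adjacent:
  assumes "is_ribbon k R" "p \<in> R" "q \<in> R" "fst q = fst p + 1"
  shows "\<bar>snd p - snd q\<bar> = 1"
proof -
  have R: "inj_on fst R" "edge_connected R" using assms(1) by (auto simp: is_ribbon_def)
  obtain a b where "a \<in> R" "b \<in> R" "fst a = fst p" "fst b = fst p + 1" "share_edge a b"
    using edge_connected_crossing[OF R(2) assms(2,3), of "fst p"] assms(4) by auto
  then have "share_edge p q" using R(1) assms by (metis inj_onD)
  then show ?thesis by (simp add: share_edge_def)
qed

lemma is_ribbonI:
  assumes "R \<subseteq> cells" "inj_on fst R" "fst ` R = {x..<x + int k}"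
    and adj: "\<And>p q. p \<in> R \<Longrightarrow> q \<in> R \<Longrightarrow> fst q = fst p + 1 \<Longrightarrow> \<bar>snd p - snd q\<bar> = 1"
  shows "is_ribbon k R"
proof -
  let ?E = "{(a, b). a \<in> R \<and> b \<in> R \<and> share_edge a b}"
  have "finite (fst ` R)" unfolding assms(3) by simp
  then have "finite R" using assms(2) by (rule finite_imageD)
  moreover have "card R = k" using card_image[OF assms(2)] assms(3) by simp
  moreover have "edge_connected R"
  proof -
    have path: "(p, q) \<in> ?E\<^sup>* \<and> (q, p) \<in> ?E\<^sup>*" if "p \<in> R" "q \<in> R" "fst q = fst p + int n" for p q n
      using that
    proof (induction n arbitrary: q)
      case 0
      then show ?case using assms(2) by (auto dest: inj_onD)
    next
      case (Suc n)
      have "fst p \<in> {x..<x + int k}" "fst q \<in> {x..<x + int k}" using Suc.prems assms(3) by blast+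
      then have "fst p + int n \<in> fst ` R" unfolding assms(3) using Suc.prems(3) by simp
      then obtain q' where q': "q' \<in> R" "fst q' = fst p + int n" by force
      then have "share_edge q' q" using adj[of q' q] Suc.prems by (simp add: share_edge_def)
      then have "(q', q) \<in> ?E" "(q, q') \<in> ?E"
        using q' Suc.prems by (auto simp: share_edge_def abs_minus_commute)
      then show ?case using Suc.IH[OF Suc.prems(1) q'] 
        by (meson converse_rtrancl_into_rtrancl rtrancl.rtrancl_into_rtrancl)
    qed
    show ?thesis unfolding edge_connected_def
    proof (intro ballI)
      fix p q assume pq: "p \<in> R" "q \<in> R"
      show "(p, q) \<in> ?E\<^sup>*"
      proof (cases "fst p \<le> fst q")
        case True
        then show ?thesis using path[OF pq, of "nat (fst q - fst p)"] by simp
      next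
        case False
        then show ?thesis using path[OF pq(2,1), of "nat (fst p - fst q)"] by simp
      qed
    qed
  qed
  ultimately show ?thesis using assms by (simp add: is_ribbon_def)
qed

section \<open>An empty core forces vanishing charges\<close>

lemma diagram_empty_partition [simp]: "diagram empty_partition = {}"
  by (auto simp: diagram_def empty_partition_def)

lemma column_size_empty [simp]: "column_size empty_partition x = 0"
  by (simp add: column_size_def)

lemma is_partition_empty: "is_partition empty_partition"
  by (simp add: is_partition_def empty_partition_def antimono_def)

text \<open>Here \<open>a x\<close> counts the removed ribbons whose leftmost box lies in column \<open>x\<close>. A ribbon adds one to
  \<open>k\<close> consecutive column sizes, and so changes only two column differences, at distance \<open>k\<close>.\<close>

lemma core_empty_columns:
  assumes "is_core k lam empty_partition" "1 \<le> k"
  obtains a :: "int \<Rightarrow> int" and N :: int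
  where "\<And>x. N \<le> \<bar>x\<bar> \<Longrightarrow> a x = 0"
    and "\<And>x. int (column_size lam (x + 1)) - int (column_size lam x) = a (x + 1) - a (x + 1 - int k)"
proof -
  have "(ribbon_removal k)\<^sup>*\<^sup>* lam empty_partition" using assms by (simp add: is_core_def)
  then have "\<exists>(a :: int \<Rightarrow> int) N. (\<forall>x. N \<le> \<bar>x\<bar> \<longrightarrow> a x = 0) \<and>
     (\<forall>x. int (column_size lam (x + 1)) - int (column_size lam x) = a (x + 1) - a (x + 1 - int k))"
  proof (induction rule: converse_rtranclp_induct)
    case base
    then show ?case by (intro exI[of _ "\<lambda>x. 0"]) simp
  next
    case (step lam mu)
    then obtain a :: "int \<Rightarrow> int" and N where a: "\<And>x. N \<le> \<bar>x\<bar> \<Longrightarrow> a x = 0"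
      "\<And>x. int (column_size mu (x + 1)) - int (column_size mu x) = a (x + 1) - a (x + 1 - int k)"
      by blast
    obtain R where R: "is_ribbon k R" "R \<subseteq> diagram lam" "diagram mu = diagram lam - R"
      and part: "is_partition mu"
      using step(1) by (auto simp: ribbon_removal_def)
    obtain x0 where x0: "fst ` R = {x0..<x0 + int k}" using ribbon_columns[OF R(1) assms(2)] .
    have inj: "inj_on fst R" using R(1) by (simp add: is_ribbon_def)
    have col: "column_size lam x = column_size mu x + of_bool (x0 \<le> x \<and> x < x0 + int k)" for x
    proof -
      have "{p \<in> diagram lam. fst p = x} = {p \<in> diagram mu. fst p = x} \<union> {p \<in> R. fst p = x}"
        using R(2,3) by auto
      moreover have "{p \<in> diagram mu. fst p = x} \<inter> {p \<in> R. fst p = x} = {}" using R(3) by auto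
      moreover have "finite R" using R(1) by (simp add: is_ribbon_def)
      ultimately have "column_size lam x = column_size mu x + card {p \<in> R. fst p = x}"
        unfolding column_size_def using finite_column[OF part, of x] by (simp add: card_Un_disjoint)
      moreover have "card {p \<in> R. fst p = x} = of_bool (x \<in> fst ` R)"
      proof (cases "x \<in> fst ` R")
        case True
        then obtain p where "p \<in> R" "fst p = x" by blast
        then have "{p \<in> R. fst p = x} = {p}" using inj by (auto dest: inj_onD)
        then show ?thesis using True by simp
      next
        case False
        then have "{p \<in> R. fst p = x} = {}" by blast
        then have "card {p \<in> R. fst p = x} = 0" by (simp only: card.empty)
        then show ?thesis using False by simp
      qed
      ultimately show ?thesis by (simp add: x0)
    qed
    show ?case
    proof (intro exI conjI allI impI)
      fix x :: int assume "max N (\<bar>x0\<bar> + 1) \<le> \<bar>x\<bar>"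
      then show "a x + of_bool (x = x0) = 0" using a(1)[of x] by auto
    next
      fix x
      show "int (column_size lam (x + 1)) - int (column_size lam x)
        = a (x + 1) + of_bool (x + 1 = x0) - (a (x + 1 - int k) + of_bool (x + 1 - int k = x0))"
      proof -
        have "of_bool (x0 \<le> x + 1 \<and> x + 1 < x0 + int k) - of_bool (x0 \<le> x \<and> x < x0 + int k)
          = (of_bool (x + 1 = x0) - of_bool (x + 1 - int k = x0) :: int)"
          using assms(2) by auto
        then show ?thesis using a(2)[of x] by (simp add: col)
      qed
    qed
  qed
  then show ?thesis using that by blast
qed

text \<open>Along a runner, the differences of column sizes telescope by \<open>core_empty_columns\<close>, and so do those
  of the partition on the runner. The words of the two agree up to the shift by \<open>c\<close>, so the two telescoping
  expressions differ by a constant plus the contribution of the rays; comparing the values far to the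
  left and far to the right gives \<open>0\<close> and \<open>c\<close>.\<close>

lemma charge_eq_0:
  assumes core: "is_core k lam empty_partition" and "1 \<le> k" and r: "r < k"
    and lam: "is_partition lam" and mu: "is_partition mu"
    and up: "\<And>l. up mu (l - c) = up lam (int k * l + int r)"
  shows "c = 0"
proof -
  obtain a :: "int \<Rightarrow> int" and N :: int where a: "\<And>x. N \<le> \<bar>x\<bar> \<Longrightarrow> a x = 0"
    "\<And>x. int (column_size lam (x + 1)) - int (column_size lam x) = a (x + 1) - a (x + 1 - int k)"
    using core_empty_columns[OF core \<open>1 \<le> k\<close>] by metis
  obtain M where M: "\<And>x. M \<le> \<bar>x\<bar> \<Longrightarrow> column_size mu x = 0"
    using column_size_eventually_0[OF mu] by blast
  define g where "g l = a (int k * (l - 1) + int r + 1) - int (column_size mu (l - c))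
      + max l 0 - max (l - c) 0" for l
  \<comment> \<open>The two maxima sum up the ray terms of \<open>column_size_diff\<close> for the runner and its shift by \<open>c\<close>.\<close>
  have step: "g (l + 1) = g l" for l
  proof -
    have nn: "int k * l + int r \<ge> 0 \<longleftrightarrow> l \<ge> 0"
    proof
      assume "int k * l + int r \<ge> 0"
      then have "int k * (l + 1) > 0" using r by (simp add: distrib_left)
      then show "l \<ge> 0" by (simp add: zero_less_mult_iff)
    qed simp
    have "a (int k * l + int r + 1) - a (int k * l + int r + 1 - int k)
        = of_bool (up lam (int k * l + int r)) - of_bool (l \<ge> 0)"
      using a(2)[of "int k * l + int r"] column_size_diff[OF lam, of "int k * l + int r"] nn by simp
    moreover have "int (column_size mu (l - c + 1)) - int (column_size mu (l - c))
        = of_bool (up lam (int k * l + int r)) - of_bool (l - c \<ge> 0)"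
      using column_size_diff[OF mu, of "l - c"] up by simp
    moreover have "max (l + 1) 0 = max l 0 + of_bool (l \<ge> 0)"
      "max (l + 1 - c) 0 = max (l - c) 0 + of_bool (l - c \<ge> 0)" by auto
    moreover have "g (l + 1) = a (int k * l + int r + 1) - int (column_size mu (l - c + 1))
        + max (l + 1) 0 - max (l + 1 - c) 0"
      unfolding g_def by (simp add: algebra_simps)
    moreover have "g l = a (int k * l + int r + 1 - int k) - int (column_size mu (l - c))
        + max l 0 - max (l - c) 0"
      unfolding g_def by (simp add: algebra_simps)
    ultimately show ?thesis by linarith
  qed
  have const: "g l = g (l + int n)" for l n
  proof (induction n)
    case (Suc n)
    then show ?case using step[of "l + int n"] by (simp add: ac_simps)
  qed simp
  define L where "L = \<bar>N\<bar> + \<bar>M\<bar> + \<bar>c\<bar> + 1"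
  have L: "\<bar>c\<bar> < L" by (simp add: L_def)
  have "int k * L \<ge> 1 * L" using \<open>1 \<le> k\<close> by (intro mult_right_mono) (auto simp: L_def)
  then have "a (int k * L + int r + 1) = 0" "a (int k * (- L - 1) + int r + 1) = 0"
    using r by (auto intro!: a(1) simp: L_def algebra_simps)
  moreover have "column_size mu (L + 1 - c) = 0" "column_size mu (- L - c) = 0"
    by (auto intro!: M simp: L_def)
  ultimately have "g (L + 1) = c" "g (- L) = 0"
    using L by (auto simp: g_def max_def)
  moreover have "g (- L) = g (L + 1)"
    using const[of "- L" "nat (2 * L + 1)"] by (simp add: L_def)
  ultimately show ?thesis by simp
qed

lemma up_quotient:
  assumes "is_core k lam empty_partition" "is_partition lam" "is_quotient k lam Q" "r < k"
  shows "is_partition (Q r)" "up (Q r) l = up lam (int k * l + int r)"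
proof -
  obtain c where c: "quotient_and_charges k lam Q c" using assms(3) by (auto simp: is_quotient_def)
  then show part: "is_partition (Q r)" using assms(4) by (simp add: quotient_and_charges_def)
  have up: "up (Q r) (l - c r) = up lam (int k * l + int r)" for l
    using c assms(4) by (simp add: quotient_and_charges_def flip: abacus_eq_iff_up)
  then have "c r = 0" using charge_eq_0 assms part by (metis One_nat_def Suc_leI gr_zeroI not_less_zero)
  then show "up (Q r) l = up lam (int k * l + int r)" using up[of l] by simp
qed

context
  fixes k j :: nat
  assumes k2: "2 \<le> k" and jk: "j < k"
begin

text \<open>Both sides have the same increments: the word of \<open>\<rho>\<close> is that of \<open>\<lambda>\<close> without the runner \<open>j\<close>, and in a
  green strip neither side changes, because there the border of \<open>\<lambda>\<close> runs parallel to the ray. Far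
  to the right both sides vanish.\<close>

lemma column_size_contract:
  assumes lam: "is_partition lam" "is_core k lam empty_partition" "is_quotient k lam Q"
    and Qj: "Q j = empty_partition"
    and rho: "is_partition rho" "is_core (k - 1) rho empty_partition"
      "is_quotient (k - 1) rho (\<lambda>i. if i < j then Q i else Q (i + 1))"
  shows "column_size rho (contract k j x) = column_size lam x"
    and "x mod int k = int j \<Longrightarrow> column_size lam (x + 1) = column_size lam x"
proof -
  note step = contract_step[OF k2 jk]
  have nn: "int k * l + int r \<ge> 0 \<longleftrightarrow> l \<ge> 0" if "r < k" for l r
  proof
    assume "int k * l + int r \<ge> 0"
    then have "int k * (l + 1) > 0" using that by (simp add: distrib_left)
    then show "l \<ge> 0" by (simp add: zero_less_mult_iff)
  qed simp
  have green: "column_size lam (x + 1) = column_size lam x" if "x mod int k = int j" for x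
  proof -
    define l where "l = x div int k"
    have x: "x = int k * l + int j" using that by (metis l_def mult_div_mod_eq)
    have "up lam x = up empty_partition l"
      using up_quotient(2)[OF lam(2,1,3) jk, of l] Qj x by simp
    also have "\<dots> \<longleftrightarrow> l \<ge> 0"
      using column_size_diff[OF is_partition_empty, of l] by auto
    finally have "up lam x \<longleftrightarrow> x \<ge> 0" using nn[OF jk, of l] x by simp
    then show ?thesis using column_size_diff[OF lam(1), of x] by simp
  qed
  then show "x mod int k = int j \<Longrightarrow> column_size lam (x + 1) = column_size lam x" .
  define F where "F x = int (column_size rho (contract k j x)) - int (column_size lam x)" for x
  have Fstep: "F (x + 1) = F x" for x
  proof (cases "x mod int k = int j")
    case True
    then show ?thesis using green step[of x] by (simp add: F_def)
  next
    case False
    obtain l r where x: "x = int k * l + int r" "r < k" "x mod int k = int r"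
      by (rule residueE[OF k2 jk])
    have rj: "r \<noteq> j" using False x by simp
    define r' where "r' = (if r < j then r else r - 1)"
    have r': "r' < k - 1" using rj x(2) jk by (auto simp: r'_def)
    have "int r' = int r - of_bool (j < r)" using rj by (auto simp: r'_def)
    then have cx: "contract k j x = int (k - 1) * l + int r'"
      using contract_eq[OF x(2) jk, of l] x(1) k2 by (simp add: of_nat_diff)
    have "up rho (contract k j x) = up ((\<lambda>i. if i < j then Q i else Q (i + 1)) r') l"
      using up_quotient(2)[OF rho(2,1,3) r', of l] cx by simp
    also have "(\<lambda>i. if i < j then Q i else Q (i + 1)) r' = Q r" using rj by (auto simp: r'_def)
    also have "up (Q r) l = up lam x" using up_quotient(2)[OF lam(2,1,3) x(2), of l] x(1) by simp
    finally have "up rho (contract k j x) = up lam x" .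
    moreover have "contract k j x \<ge> 0 \<longleftrightarrow> x \<ge> 0"
    proof
      assume "0 \<le> contract k j x"
      then show "0 \<le> x" using contract_nonpos[OF k2 jk, of "x + 1"] step[of x] False by (cases "x \<ge> 0") auto
    qed (rule contract_nonneg[OF k2 jk])
    ultimately show ?thesis
      using column_size_diff[OF rho(1), of "contract k j x"] column_size_diff[OF lam(1), of x]
        step[of x] False by (simp add: F_def)
  qed
  have const: "F y = F (y + int n)" for y n
  proof (induction n)
    case (Suc n)
    then show ?case using Fstep[of "y + int n"] by (simp add: ac_simps)
  qed simp
  obtain N where N: "\<And>x. N \<le> \<bar>x\<bar> \<Longrightarrow> column_size lam x = 0"
    using column_size_eventually_0[OF lam(1)] by blast
  obtain M where M: "\<And>x. M \<le> \<bar>x\<bar> \<Longrightarrow> column_size rho x = 0"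
    using column_size_eventually_0[OF rho(1)] by blast
  obtain y where y: "contract k j y = \<bar>N\<bar> + \<bar>M\<bar> + 1" using contract_surj[OF k2 jk] by blast
  have le: "contract k j z \<le> z" if "0 \<le> z" for z
    using that
  proof (induction z rule: int_ge_induct)
    case base
    then show ?case using contract_0[OF k2 jk] by simp
  next
    case (step z)
    then show ?case using contract_step[OF k2 jk, of z] by (simp split: if_splits)
  qed
  have y0: "0 \<le> y" using contract_nonpos[OF k2 jk, of y] y by linarith
  have big: "F z = 0" if "y \<le> z" for z
  proof -
    have "contract k j y \<le> contract k j z" using contract_mono[OF k2 jk that] .
    then have "column_size rho (contract k j z) = 0" "column_size lam z = 0"
      using y le[of z] y0 that by (auto intro!: M N)
    then show ?thesis by (simp add: F_def)
  qed
  have "F x = 0" using const[of x "nat (\<bar>x\<bar> + y)"] big[of "x + int (nat (\<bar>x\<bar> + y))"] y0 by simp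
  then show "column_size rho (contract k j x) = column_size lam x" by (simp add: F_def)
qed

end

section \<open>Compressing a tile slides boxes\<close>

lemma closed_region: "finite C \<Longrightarrow> closed (region C)"
  unfolding region_def box_at_def
  by (intro closed_UN) (auto split: prod.splits intro!: compact_imp_closed finite_imp_compact_convex_hull)

text \<open>A region determines its boxes: by parity, two different centers have distance at least two in the
  norm whose unit balls are the boxes.\<close>

lemma center_in_region_iff:
  assumes "p \<in> cells" "R \<subseteq> cells"
  shows "Complex (of_int (fst p)) (of_int (snd p)) \<in> region R \<longleftrightarrow> p \<in> R"
proof
  assume "Complex (of_int (fst p)) (of_int (snd p)) \<in> region R"
  then obtain q where q: "q \<in> R"
    "\<bar>real_of_int (fst p) - of_int (fst q)\<bar> + \<bar>real_of_int (snd p) - of_int (snd q)\<bar> \<le> 1"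
    by (auto simp: region_def box_at_eq)
  then have "real_of_int (\<bar>fst p - fst q\<bar> + \<bar>snd p - snd q\<bar>) \<le> 1" by simp
  then have le: "\<bar>fst p - fst q\<bar> + \<bar>snd p - snd q\<bar> \<le> 1" by linarith
  have "odd (fst p + snd p)" "odd (fst q + snd q)" using assms q(1) by (auto simp: cells_def)
  then have "even (\<bar>fst p - fst q\<bar> + \<bar>snd p - snd q\<bar>)" by auto
  then have "\<bar>fst p - fst q\<bar> + \<bar>snd p - snd q\<bar> = 0" using le by presburger
  then have "fst p = fst q" "snd p = snd q" by linarith+
  then have "p = q" by (rule prod_eqI)
  then show "p \<in> R" using q by simp
next
  assume "p \<in> R"
  then show "Complex (of_int (fst p)) (of_int (snd p)) \<in> region R"
    unfolding region_def by (force simp: box_at_eq)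
qed

lemma region_inj:
  assumes "region R = region S" "R \<subseteq> cells" "S \<subseteq> cells"
  shows "R = S"
  using assms center_in_region_iff by blast

definition shift :: "nat \<Rightarrow> nat \<Rightarrow> int \<Rightarrow> complex" where
  "shift k j x = Complex (of_int (contract k j x - x)) (of_int (\<bar>contract k j x\<bar> - \<bar>x\<bar>))"

lemma box_at_contract_cell:
  "z + shift k j (fst p) \<in> box_at (contract_cell k j p) \<longleftrightarrow> z \<in> box_at p"
  by (simp add: box_at_eq shift_def contract_cell_def algebra_simps)

text \<open>With each box that touches a green strip, the set contains the box on the other side with which it
  is merged. For such sets the removal of green strips merges boxes in pairs and leaves no half
  boxes.\<close>

definition seam_closed :: "nat \<Rightarrow> nat \<Rightarrow> (int \<times> int) set \<Rightarrow> bool" where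
  "seam_closed k j R \<longleftrightarrow>
     (\<forall>p\<in>R. fst p mod int k = int j \<longrightarrow>
        (\<exists>q\<in>R. fst q = fst p + 1 \<and> contract_cell k j q = contract_cell k j p)) \<and>
     (\<forall>q\<in>R. (fst q - 1) mod int k = int j \<longrightarrow>
        (\<exists>p\<in>R. fst p = fst q - 1 \<and> contract_cell k j p = contract_cell k j q))"

lemma open_box_subset_interior:
  "{z. \<bar>Re z - a\<bar> + \<bar>Im z - b\<bar> < (1::real)} \<subseteq> interior {z. \<bar>Re z - a\<bar> + \<bar>Im z - b\<bar> \<le> 1}"
proof (rule interior_maximal)
  show "open {z. \<bar>Re z - a\<bar> + \<bar>Im z - b\<bar> < (1::real)}"
    by (intro open_Collect_less continuous_intros)
qed auto

context
  fixes k j :: nat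
  assumes k2: "2 \<le> k" and jk: "j < k"
begin

lemma shift_step:
  assumes "x mod int k \<noteq> int j"
  shows "shift k j (x + 1) = shift k j x"
  using contract_step[OF k2 jk, of x] abs_contract_step[OF k2 jk assms] assms
  by (simp add: shift_def)

lemma slide_eq_shift:
  assumes "\<lfloor>Re z\<rfloor> = x" "x mod int k \<noteq> int j"
  shows "slide k j z = z + shift k j x"
  using slide_eq[OF k2 jk assms] by (simp add: shift_def)

text \<open>If \<open>Re z\<close> is an integer, \<open>z\<close> may be the right corner of a box, which moves differently from the box
  when the slide jumps there. Points slightly to the right of \<open>z\<close> avoid this; as the slide is continuous from
  the right and the target is closed, they suffice.\<close>

lemma slide_mem:
  assumes "finite R" "z \<in> interior (region R)" "z \<notin> green k j"
  shows "slide k j z \<in> region (contract_cell k j ` R)"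
proof -
  define x where "x = \<lfloor>Re z\<rfloor>"
  have x: "x mod int k \<noteq> int j" using assms(3) green_iff[OF k2 jk] x_def by simp
  obtain e where e: "e > 0" "ball z e \<subseteq> region R"
    using assms(2) mem_interior by blast
  define d where "d = min e (of_int x + 1 - Re z)"
  have d: "d > 0" using e(1) by (simp add: d_def x_def)
  have mem: "slide k j z + of_real t \<in> region (contract_cell k j ` R)" if t: "0 < t" "t < d" for t
  proof -
    have "z + of_real t \<in> ball z e" using t by (simp add: d_def dist_norm)
    then obtain p where p: "p \<in> R" "z + of_real t \<in> box_at p"
      using e(2) by (auto simp: region_def)
    have Re: "of_int x < Re z + t" "Re z + t < of_int x + 1" using t by (simp_all add: d_def x_def) linarith
    moreover have "\<bar>Re z + t - of_int (fst p)\<bar> \<le> 1" using p(2) by (simp add: box_at_eq)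
    ultimately have "real_of_int x - 1 < of_int (fst p)" "real_of_int (fst p) < of_int x + 2" by linarith+
    then have "fst p = x \<or> fst p = x + 1" by linarith
    then have "shift k j (fst p) = shift k j x" using shift_step[OF x] by auto
    then have "slide k j z + of_real t = (z + of_real t) + shift k j (fst p)"
      using slide_eq_shift[OF x_def[symmetric] x] by simp
    then have "slide k j z + of_real t \<in> box_at (contract_cell k j p)"
      using p(2) by (simp only: box_at_contract_cell)
    then show ?thesis using p(1) by (auto simp: region_def)
  qed
  have "((\<lambda>t. slide k j z + of_real t) \<longlongrightarrow> slide k j z + of_real 0) (at_right 0)"
    by (intro tendsto_intros)
  moreover have "\<forall>\<^sub>F t in at_right 0. slide k j z + of_real t \<in> region (contract_cell k j ` R)"
    using eventually_at_right_real[OF d] by eventually_elim (use mem in auto)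
  moreover have "closed (region (contract_cell k j ` R))"
    using assms(1) by (intro closed_region) simp
  ultimately have "slide k j z + of_real 0 \<in> region (contract_cell k j ` R)"
    by (intro Lim_in_closed_set) auto
  then show ?thesis by simp
qed

lemma half_box_slide:
  assumes "p \<in> R" "x mod int k \<noteq> int j" "x = fst p \<or> x + 1 = fst p"
    and "of_int (contract k j x) < Re w" "Re w < of_int (contract k j x) + 1"
    and "\<bar>Re w - of_int (fst (contract_cell k j p))\<bar> + \<bar>Im w - of_int (snd (contract_cell k j p))\<bar> < 1"
  shows "w \<in> slide k j ` (interior (region R) - green k j)"
proof -
  define z where "z = w - shift k j x"
  have shift: "shift k j (fst p) = shift k j x" using shift_step[OF assms(2)] assms(3) by auto
  have "\<bar>Re z - of_int (fst p)\<bar> + \<bar>Im z - of_int (snd p)\<bar> < 1"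
    using assms(6) unfolding z_def shift[symmetric] by (simp add: shift_def contract_cell_def algebra_simps)
  then have "z \<in> interior (box_at p)"
    unfolding box_at_eq using open_box_subset_interior by blast
  moreover have "box_at p \<subseteq> region R" using assms(1) by (auto simp: region_def)
  ultimately have "z \<in> interior (region R)" using interior_mono by blast
  moreover have fl: "\<lfloor>Re z\<rfloor> = x"
    using assms(4,5) by (simp add: z_def shift_def floor_eq_iff)
  moreover have "z \<notin> green k j" using green_iff[OF k2 jk] fl assms(2) by simp
  moreover have "slide k j z = w" using slide_eq_shift[OF fl assms(2)] by (simp add: z_def)
  ultimately show ?thesis by blast
qed

text \<open>The inclusion from right to left approximates a point of a merged box by points of the open left
  or right half, moving towards the midpoint of that half. Each half is the image of the half of one of
  the at most two boxes that merge into it, namely one where the half is not green.\<close>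

lemma compressed_tile_region:
  assumes "finite R" "seam_closed k j R"
  shows "compressed_tile k j (region R) = region (contract_cell k j ` R)"
proof
  let ?S = "slide k j ` (interior (region R) - green k j)"
  show "compressed_tile k j (region R) \<subseteq> region (contract_cell k j ` R)"
    unfolding compressed_tile_def
    by (rule closure_minimal) (use assms(1) slide_mem in \<open>auto intro!: closed_region\<close>)
  show "region (contract_cell k j ` R) \<subseteq> compressed_tile k j (region R)"
  proof
    fix w assume "w \<in> region (contract_cell k j ` R)"
    then obtain p where p: "p \<in> R" "w \<in> box_at (contract_cell k j p)"
      by (auto simp: region_def)
    define a b where "a = fst (contract_cell k j p)" and "b = snd (contract_cell k j p)"
    have w: "\<bar>Re w - of_int a\<bar> + \<bar>Im w - of_int b\<bar> \<le> 1"
      using p(2) by (simp add: box_at_eq a_def b_def)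
    \<comment> \<open>The half containing \<open>w\<close> is the right one for \<open>s = 1\<close>, and \<open>c\<close> is its midpoint.\<close>
    define s :: real where "s = (if Re w \<ge> of_int a then 1 else - 1)"
    define c where "c = Complex (of_int a + s / 2) (of_int b)"
    have mem: "w + of_real t * (c - w) \<in> ?S" if t: "0 < t" "t < 1" for t
    proof -
      define v where "v = w + of_real t * (c - w)"
      have Re: "Re v - of_int a = (1 - t) * (Re w - of_int a) + t * (s / 2)"
        by (simp add: v_def c_def algebra_simps)
      have Im: "Im v - of_int b = (1 - t) * (Im w - of_int b)"
        by (simp add: v_def c_def algebra_simps)
      have abs: "\<bar>Re v - of_int a\<bar> = (1 - t) * \<bar>Re w - of_int a\<bar> + t / 2"
      proof (cases "Re w \<ge> of_int a")
        case True
        then have "(1 - t) * (Re w - of_int a) \<ge> 0" using t by simp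
        then show ?thesis unfolding Re using t True by (simp add: s_def)
      next
        case False
        then have "(1 - t) * (Re w - of_int a) \<le> 0" using t by (simp add: mult_le_0_iff)
        then have "\<bar>(1 - t) * (Re w - of_int a) - t / 2\<bar> = t / 2 - (1 - t) * (Re w - of_int a)"
          using t by linarith
        then show ?thesis unfolding Re using False by (simp add: s_def algebra_simps)
      qed
      have Im_abs: "\<bar>Im v - of_int b\<bar> = (1 - t) * \<bar>Im w - of_int b\<bar>"
        using t by (simp add: Im abs_mult)
      have lt: "\<bar>Re v - of_int a\<bar> + \<bar>Im v - of_int b\<bar> < 1"
      proof -
        have "\<bar>Re v - of_int a\<bar> + \<bar>Im v - of_int b\<bar>
            = (1 - t) * (\<bar>Re w - of_int a\<bar> + \<bar>Im w - of_int b\<bar>) + t / 2"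
          unfolding abs Im_abs by (simp add: algebra_simps)
        also have "\<dots> \<le> (1 - t) * 1 + t / 2" using w t by (intro add_right_mono mult_left_mono) auto
        finally show ?thesis using t by simp
      qed
      show ?thesis
      proof (cases "Re w \<ge> of_int a")
        case True
        have "(1 - t) * (Re w - of_int a) \<ge> 0" using t True by simp
        moreover have "Re v - of_int a = (1 - t) * (Re w - of_int a) + t / 2"
          using Re True by (simp add: s_def)
        ultimately have v: "of_int a < Re v" "Re v < of_int a + 1"
          using t lt by linarith+
        obtain q where q: "q \<in> R" "contract_cell k j q = contract_cell k j p" "fst q mod int k \<noteq> int j"
          using assms(2) p(1) green_Suc[OF k2 jk, of "fst p"] unfolding seam_closed_def by metis
        have "contract k j (fst q) = a" using q(2) by (metis a_def fst_contract_cell)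
        then show ?thesis
          using half_box_slide[of q R "fst q" v] q v lt by (simp add: a_def b_def v_def)
      next
        case False
        have "(1 - t) * (Re w - of_int a) \<le> 0" using t False by (simp add: mult_le_0_iff)
        moreover have "Re v - of_int a = (1 - t) * (Re w - of_int a) - t / 2"
          using Re False by (simp add: s_def)
        ultimately have v: "of_int a - 1 < Re v" "Re v < of_int a"
          using t lt by linarith+
        obtain q where q: "q \<in> R" "contract_cell k j q = contract_cell k j p" "(fst q - 1) mod int k \<noteq> int j"
          using assms(2) p(1) green_Suc[OF k2 jk, of "fst p - 1 - 1"] unfolding seam_closed_def
          by (metis diff_add_cancel)
        have "contract k j (fst q) = a" using q(2) by (metis a_def fst_contract_cell)
        then have "contract k j (fst q - 1) = a - 1"
          using contract_step[OF k2 jk, of "fst q - 1"] q(3) by simp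
        then show ?thesis
          using half_box_slide[of q R "fst q - 1" v] q v lt by (simp add: a_def b_def v_def)
      qed
    qed
    have "((\<lambda>t. w + of_real t * (c - w)) \<longlongrightarrow> w + of_real 0 * (c - w)) (at_right 0)"
      by (intro tendsto_intros)
    moreover have "\<forall>\<^sub>F t in at_right (0::real). w + of_real t * (c - w) \<in> closure ?S"
      using eventually_at_right_real[OF zero_less_one]
      by eventually_elim (use mem closure_subset in force)
    ultimately have "w + of_real 0 * (c - w) \<in> closure ?S"
      by (intro Lim_in_closed_set) auto
    then show "w \<in> compressed_tile k j (region R)" by (simp add: compressed_tile_def)
  qed
qed

end

section \<open>Tilings respect the green strips\<close>

text \<open>From here on, all that matters about \<open>\<rho>\<close> and the empty quotient is the conclusion of
  \<open>column_size_contract\<close>.\<close>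

context
  fixes k j :: nat and lam rho :: "nat \<Rightarrow> nat"
  assumes k2: "2 \<le> k" and jk: "j < k"
    and lam: "is_partition lam" and rho: "is_partition rho"
    and contract_size: "\<And>x. column_size rho (contract k j x) = column_size lam x"
    and green_size: "\<And>x. x mod int k = int j \<Longrightarrow> column_size lam (x + 1) = column_size lam x"
begin

text \<open>The inverse of contracting a tile: boxes in merged columns are split again.\<close>

definition expand :: "(int \<times> int) set \<Rightarrow> (int \<times> int) set" where
  "expand R = {p \<in> diagram lam. contract_cell k j p \<in> R}"

lemma contract_mem:
  assumes "p \<in> diagram lam"
  shows "contract_cell k j p \<in> diagram rho"
proof -
  obtain x i where p: "p = cell x i" using assms diagram_memE by blast
  then have "i < column_size rho (contract k j x)"
    using assms cell_in_diagram[OF lam] contract_size[of x] by simp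
  then show ?thesis using p cell_in_diagram[OF rho] by simp
qed

lemma contract_mem_ex:
  assumes "q \<in> diagram rho" "contract k j x = fst q"
  obtains p where "p \<in> diagram lam" "fst p = x" "contract_cell k j p = q"
proof -
  obtain i where i: "q = cell (fst q) i" using assms(1) diagram_memE by blast
  then have "i < column_size rho (fst q)" using assms(1) cell_in_diagram[OF rho] by metis
  then have "cell x i \<in> diagram lam"
    using assms(2) cell_in_diagram[OF lam] contract_size[of x] by simp
  moreover have "contract_cell k j (cell x i) = q" using i assms(2) by simp
  ultimately show ?thesis using that[of "cell x i"] by simp
qed

lemma contract_cell_expand:
  assumes "R \<subseteq> diagram rho"
  shows "contract_cell k j ` expand R = R"
proof
  show "contract_cell k j ` expand R \<subseteq> R" by (auto simp: expand_def)
  show "R \<subseteq> contract_cell k j ` expand R"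
  proof
    fix q assume q: "q \<in> R"
    obtain x where x: "contract k j x = fst q" using contract_surj[OF k2 jk] by blast
    obtain p where "p \<in> diagram lam" "contract_cell k j p = q"
      using contract_mem_ex[of q x] q x assms by blast
    then show "q \<in> contract_cell k j ` expand R" using q by (force simp: expand_def)
  qed
qed

lemma contract_image: "contract_cell k j ` diagram lam = diagram rho"
  using contract_cell_expand[of "diagram rho"] contract_mem by (force simp: expand_def)

text \<open>Two boxes in neighbouring columns of the expansion are either the two parts of one split box or lie
  over two neighbouring boxes of the contracted ribbon.\<close>

lemma expand_ribbon:
  assumes "is_ribbon (k - 1) R" "R \<subseteq> diagram rho"
  shows "is_ribbon k (expand R)"
proof -
  have inj: "inj_on fst R" using assms(1) by (simp add: is_ribbon_def)
  have k1: "1 \<le> k - 1" using k2 by simp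
  obtain v where v: "fst ` R = {v..<v + int (k - 1)}" using ribbon_columns[OF assms(1)] k1 by blast
  obtain x where x: "contract k j x = v" "(x - 1) mod int k \<noteq> int j"
    using contract_interval_start[OF k2 jk] .
  have iv: "contract k j y \<in> fst ` R \<longleftrightarrow> y \<in> {x..<x + int k}" for y
    using contract_interval[OF k2 jk x(2), of y] x(1) v k2 by (simp add: of_nat_diff algebra_simps)
  show ?thesis
  proof (rule is_ribbonI)
    show "expand R \<subseteq> cells" using diagram_subset_cells by (auto simp: expand_def)
    show "inj_on fst (expand R)"
    proof (rule inj_onI)
      fix p q assume pq: "p \<in> expand R" "q \<in> expand R" "fst p = fst q"
      then have "contract_cell k j p = contract_cell k j q"
        using inj by (auto simp: expand_def dest!: inj_onD[of fst R "contract_cell k j p" "contract_cell k j q"])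
      then show "p = q" using pq(3) by (simp add: contract_cell_def prod_eq_iff)
    qed
    show "fst ` expand R = {x..<x + int k}"
    proof
      show "fst ` expand R \<subseteq> {x..<x + int k}"
      proof
        fix y assume "y \<in> fst ` expand R"
        then obtain p where "fst p = y" "contract_cell k j p \<in> R" by (auto simp: expand_def)
        then have "contract k j y \<in> fst ` R" by (metis fst_contract_cell imageI)
        then show "y \<in> {x..<x + int k}" using iv by blast
      qed
      show "{x..<x + int k} \<subseteq> fst ` expand R"
      proof
        fix y assume "y \<in> {x..<x + int k}"
        then obtain q where q: "q \<in> R" "contract k j y = fst q" using iv by blast
        obtain p where "p \<in> diagram lam" "fst p = y" "contract_cell k j p = q"
          using contract_mem_ex[of q y] q assms(2) by blast
        then show "y \<in> fst ` expand R" using q by (force simp: expand_def)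
      qed
    qed
  next
    fix p q assume pq: "p \<in> expand R" "q \<in> expand R" "fst q = fst p + 1"
    let ?p = "contract_cell k j p" and ?q = "contract_cell k j q"
    have R: "?p \<in> R" "?q \<in> R" using pq by (auto simp: expand_def)
    show "\<bar>snd p - snd q\<bar> = 1"
    proof (cases "fst p mod int k = int j")
      case True
      have same: "contract k j (fst q) = contract k j (fst p)"
        using contract_step[OF k2 jk, of "fst p"] True pq(3) by simp
      then have "?p = ?q" using inj R by (auto intro: inj_onD)
      then have "snd q - \<bar>fst q\<bar> = snd p - \<bar>fst p\<bar>"
        by (simp add: contract_cell_def same)
      then show ?thesis using pq(3) by (auto simp: abs_if split: if_splits)
    next
      case False
      then have "fst ?q = fst ?p + 1"
        using contract_step[OF k2 jk, of "fst p"] pq(3) by simp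
      then have "\<bar>snd ?p - snd ?q\<bar> = 1" using ribbon_adjacent[OF assms(1) R] by blast
      moreover have "snd ?p - snd ?q = snd p - snd q"
        using abs_contract_step[OF k2 jk False] pq(3) by (simp add: contract_cell_def)
      ultimately show ?thesis by simp
    qed
  qed
qed

text \<open>A seam-closed ribbon cannot start directly after a green strip, so \<open>contract_interval\<close> applies to
  its columns. For the adjacency of two contracted boxes, representatives in neighbouring columns are chosen:
  on the right side of a green strip for the left box, on the left side for the right box.\<close>

lemma contract_ribbon:
  assumes R: "is_ribbon k R" "R \<subseteq> diagram lam" and seam: "seam_closed k j R"
  shows "is_ribbon (k - 1) (contract_cell k j ` R)"
proof -
  have inj: "inj_on fst R" using R(1) by (simp add: is_ribbon_def)
  have right: "\<exists>q\<in>R. fst q = fst p + 1 \<and> contract_cell k j q = contract_cell k j p"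
    if "p \<in> R" "fst p mod int k = int j" for p
    using seam that unfolding seam_closed_def by blast
  have left: "\<exists>p\<in>R. fst p = fst q - 1 \<and> contract_cell k j p = contract_cell k j q"
    if "q \<in> R" "(fst q - 1) mod int k = int j" for q
    using seam that unfolding seam_closed_def by blast
  obtain x where x: "fst ` R = {x..<x + int k}" using ribbon_columns[OF R(1)] k2 by auto
  have start: "(x - 1) mod int k \<noteq> int j"
  proof
    assume g: "(x - 1) mod int k = int j"
    have "x \<in> fst ` R" unfolding x using k2 by simp
    then obtain q where "q \<in> R" "fst q = x" by blast
    then obtain p where "p \<in> R" "fst p = x - 1" using left[of q] g by auto
    then have "x - 1 \<in> fst ` R" by force
    then show False unfolding x by simp
  qed
  note iv = contract_interval[OF k2 jk start]
  have eq_right: "contract_cell k j p = contract_cell k j q"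
    if pq: "p \<in> R" "q \<in> R" "fst p < fst q" "contract k j (fst p) = contract k j (fst q)" for p q
  proof -
    have "fst q = fst p + 1" "fst p mod int k = int j"
      using contract_eq_cases[OF k2 jk pq(4,3)] by auto
    moreover from this obtain q' where q': "q' \<in> R" "fst q' = fst p + 1"
        "contract_cell k j q' = contract_cell k j p"
      using right[OF pq(1)] by blast
    ultimately have "q' = q" using inj_onD[OF inj, of q' q] pq(2) by simp
    then show ?thesis using q'(3) by simp
  qed
  show ?thesis
  proof (rule is_ribbonI)
    show "contract_cell k j ` R \<subseteq> cells" using R(2) contract_mem diagram_subset_cells by blast
    show "inj_on fst (contract_cell k j ` R)"
    proof (rule inj_onI)
      fix p' q' assume "p' \<in> contract_cell k j ` R" "q' \<in> contract_cell k j ` R" "fst p' = fst q'"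
      then obtain p q where pq: "p \<in> R" "q \<in> R" "fst (contract_cell k j p) = fst (contract_cell k j q)"
        and p'q': "p' = contract_cell k j p" "q' = contract_cell k j q" by auto
      consider "fst p = fst q" | "fst p < fst q" | "fst q < fst p" by linarith
      then show "p' = q'"
      proof cases
        case 1
        then have "p = q" using inj pq(1,2) by (metis inj_onD)
        then show ?thesis by (simp add: p'q')
      next
        case 2
        then show ?thesis using eq_right[OF pq(1,2)] pq(3) by (simp add: p'q')
      next
        case 3
        then show ?thesis using eq_right[OF pq(2,1)] pq(3) by (simp add: p'q')
      qed
    qed
    have "fst ` contract_cell k j ` R = contract k j ` {x..<x + int k}"
      unfolding x[symmetric] by (simp add: image_image)
    also have "\<dots> = {contract k j x..<contract k j x + int (k - 1)}"
    proof
      show "contract k j ` {x..<x + int k} \<subseteq> {contract k j x..<contract k j x + int (k - 1)}"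
      proof
        fix v assume "v \<in> contract k j ` {x..<x + int k}"
        then obtain y where "v = contract k j y" "y \<in> {x..<x + int k}" by blast
        then show "v \<in> {contract k j x..<contract k j x + int (k - 1)}"
          using iv[of y] k2 by (simp add: of_nat_diff)
      qed
      show "{contract k j x..<contract k j x + int (k - 1)} \<subseteq> contract k j ` {x..<x + int k}"
      proof
        fix v assume v: "v \<in> {contract k j x..<contract k j x + int (k - 1)}"
        obtain y where "v = contract k j y" using contract_surj[OF k2 jk, of v] by blast
        moreover from this have "y \<in> {x..<x + int k}" using iv[of y] v k2 by (simp add: of_nat_diff)
        ultimately show "v \<in> contract k j ` {x..<x + int k}" by blast
      qed
    qed
    finally show "fst ` contract_cell k j ` R = {contract k j x..<contract k j x + int (k - 1)}" .
  next
    fix p' q' assume "p' \<in> contract_cell k j ` R" "q' \<in> contract_cell k j ` R" "fst q' = fst p' + 1"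
    then obtain p0 q0 where pq0: "p0 \<in> R" "p' = contract_cell k j p0" "q0 \<in> R" "q' = contract_cell k j q0"
      "contract k j (fst q0) = contract k j (fst p0) + 1"
      by (metis (no_types, lifting) fst_contract_cell imageE)
    obtain p where p: "p \<in> R" "contract_cell k j p = p'" "fst p mod int k \<noteq> int j"
    proof (cases "fst p0 mod int k = int j")
      case True
      then obtain q where "q \<in> R" "fst q = fst p0 + 1" "contract_cell k j q = contract_cell k j p0"
        using right[OF pq0(1)] by blast
      then show thesis using that[of q] green_Suc[OF k2 jk True] pq0(2) by simp
    next
      case False
      then show thesis using that[of p0] pq0(1,2) by simp
    qed
    have cp: "contract k j (fst p) = contract k j (fst p0)"
      using p(2) pq0(2) by (metis fst_contract_cell)
    have step: "contract k j (fst p + 1) = contract k j (fst p) + 1"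
      using contract_step[OF k2 jk, of "fst p"] p(3) by simp
    have same: "contract k j (fst p + 1) = contract k j (fst q0)" using step cp pq0(5) by simp
    obtain q where q: "q \<in> R" "contract_cell k j q = q'" "fst q = fst p + 1"
    proof -
      consider "fst q0 = fst p + 1" | "fst p + 1 < fst q0" | "fst q0 < fst p + 1" by linarith
      then show thesis
      proof cases
        case 1
        then show ?thesis using that[of q0] pq0(3,4) by simp
      next
        case 2
        have "fst q0 = fst p + 1 + 1" "(fst p + 1) mod int k = int j"
          using contract_eq_cases[OF k2 jk same 2] by auto
        then obtain q where "q \<in> R" "fst q = fst q0 - 1" "contract_cell k j q = contract_cell k j q0"
          using left[OF pq0(3)] by (metis add_diff_cancel_right')
        then show ?thesis using that[of q] pq0(4) \<open>fst q0 = fst p + 1 + 1\<close> by simp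
      next
        case 3
        have "fst q0 = fst p" "fst q0 mod int k = int j"
          using contract_eq_cases[OF k2 jk same[symmetric] 3] by auto
        then show ?thesis using p(3) by simp
      qed
    qed
    have "\<bar>snd p - snd q\<bar> = 1" using ribbon_adjacent[OF R(1) p(1) q(1,3)] .
    moreover have "snd (contract_cell k j p) - snd (contract_cell k j q) = snd p - snd q"
      using abs_contract_step[OF k2 jk p(3)] q(3) by (simp add: contract_cell_def)
    ultimately show "\<bar>snd p' - snd q'\<bar> = 1" using p(2) q(2) by simp
  qed
qed

text \<open>The tiles meeting a column correspond to its boxes. As both columns at a green strip have the same
  size, it suffices that each tile meeting the left one meets the right one. A tile violating this ends at the
  strip, hence starts directly after the previous green strip, which is impossible by induction; far
  to the left there are no boxes.\<close>

lemma tile_crosses_green: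
  assumes P: "partition_on (diagram lam) P" "\<And>R. R \<in> P \<Longrightarrow> is_ribbon k R"
    and x: "x mod int k = int j" and R: "R \<in> P"
  shows "x \<in> fst ` R \<longleftrightarrow> x + 1 \<in> fst ` R"
proof -
  define S where "S x = {R \<in> P. x \<in> fst ` R}" for x
  have bij: "\<exists>f. bij_betw f (S x) {p \<in> diagram lam. fst p = x}" for x
  proof -
    define f where "f R = (SOME p. p \<in> R \<and> fst p = x)" for R :: "(int \<times> int) set"
    have f: "f R \<in> R" "fst (f R) = x" if "R \<in> S x" for R
    proof -
      have "\<exists>p. p \<in> R \<and> fst p = x" using that by (auto simp: S_def)
      then have "f R \<in> R \<and> fst (f R) = x" unfolding f_def by (rule someI_ex)
      then show "f R \<in> R" "fst (f R) = x" by simp_all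
    qed
    have "bij_betw f (S x) {p \<in> diagram lam. fst p = x}"
    proof (rule bij_betw_imageI)
      show "inj_on f (S x)"
      proof (rule inj_onI)
        fix R R' assume RR: "R \<in> S x" "R' \<in> S x" "f R = f R'"
        have "f R \<in> R \<inter> R'" using f(1)[OF RR(1)] f(1)[OF RR(2)] RR(3) by simp
        moreover have "R \<in> P" "R' \<in> P" using RR by (auto simp: S_def)
        ultimately show "R = R'" using partition_onD2[OF P(1)] by (auto simp: disjoint_def)
      qed
      show "f ` S x = {p \<in> diagram lam. fst p = x}"
      proof
        show "f ` S x \<subseteq> {p \<in> diagram lam. fst p = x}"
        proof
          fix p assume "p \<in> f ` S x"
          then obtain R where R: "R \<in> S x" "p = f R" by blast
          then have "R \<subseteq> diagram lam" using partition_onD1[OF P(1)] by (auto simp: S_def)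
          then show "p \<in> {p \<in> diagram lam. fst p = x}" using f[OF R(1)] R(2) by auto
        qed
        show "{p \<in> diagram lam. fst p = x} \<subseteq> f ` S x"
        proof
          fix p assume "p \<in> {p \<in> diagram lam. fst p = x}"
          then obtain R where R: "R \<in> P" "p \<in> R" "fst p = x" using partition_onD1[OF P(1)] by auto
          then have "R \<in> S x" by (auto simp: S_def)
          have "inj_on fst R" using P(2)[OF R(1)] by (simp add: is_ribbon_def)
          then have "f R = p" by (rule inj_onD) (use f[OF \<open>R \<in> S x\<close>] R in auto)
          then show "p \<in> f ` S x" using \<open>R \<in> S x\<close> by blast
        qed
      qed
    qed
    then show ?thesis by blast
  qed
  have finS: "finite (S x)" for x
    using bij[of x] finite_column[OF lam, of x] bij_betw_finite by blast
  have cardS: "card (S x) = column_size lam x" for x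
    using bij[of x] bij_betw_same_card unfolding column_size_def by blast
  obtain N where N: "\<And>x. N \<le> \<bar>x\<bar> \<Longrightarrow> column_size lam x = 0"
    using column_size_eventually_0[OF lam] by blast
  have main: "S x = S (x + 1)" if "x < int n - \<bar>N\<bar>" "x mod int k = int j" for x n
    using that
  proof (induction n arbitrary: x)
    case 0
    then have "column_size lam x = 0" "column_size lam (x + 1) = 0"
      using N[of x] N[of "x + 1"] by auto
    then have "S x = {}" "S (x + 1) = {}"
      using cardS[of x] cardS[of "x + 1"] finS[of x] finS[of "x + 1"] by simp_all
    then show ?case by simp
  next
    case (Suc n)
    have "S x \<subseteq> S (x + 1)"
    proof
      fix R assume R: "R \<in> S x"
      then have RP: "R \<in> P" "x \<in> fst ` R" by (auto simp: S_def)
      obtain y where y: "fst ` R = {y..<y + int k}" using ribbon_columns[OF P(2)[OF RP(1)]] k2 by auto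
      show "R \<in> S (x + 1)"
      proof (rule ccontr)
        assume "R \<notin> S (x + 1)"
        then have "x + 1 \<notin> fst ` R" using RP(1) by (simp add: S_def)
        then have yx: "y = x - int k + 1" using RP(2) unfolding y by auto
        have "S (x - int k) = S (x - int k + 1)"
          using Suc.prems k2 by (intro Suc.IH) simp_all
        moreover have "R \<in> S (x - int k + 1)"
          using RP(1) k2 unfolding S_def mem_Collect_eq y yx by simp
        ultimately have "R \<in> S (x - int k)" by simp
        then have "x - int k \<in> fst ` R" by (simp only: S_def mem_Collect_eq)
        then show False unfolding y yx by simp
      qed
    qed
    then show ?case
      by (rule card_subset_eq[OF finS]) (simp add: cardS green_size[OF Suc.prems(2)])
  qed
  have "S x = S (x + 1)"
    by (rule main[of x "nat (x + \<bar>N\<bar> + 1)"]) (use x in auto)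
  then show ?thesis using R by (auto simp: S_def)
qed

text \<open>Right of the origin, the box at level \<open>i\<close> of the left column is adjacent to the levels \<open>i\<close> and \<open>i - 1\<close>
  of the right column. The lower one already shares a tile with the box at level \<open>i - 1\<close> of the left column, and a
  tile has only one box per column. Left of the origin the two columns exchange roles.\<close>

lemma green_neighbours_same_tile:
  assumes P: "partition_on (diagram lam) P" "\<And>R. R \<in> P \<Longrightarrow> is_ribbon k R"
    and x: "x mod int k = int j" and i: "i < column_size lam x"
  shows "\<exists>R\<in>P. cell x i \<in> R \<and> cell (x + 1) i \<in> R"
  using i
proof (induction i rule: less_induct)
  case (less i)
  have tile: "\<exists>R\<in>P. p \<in> R" if "p \<in> diagram lam" for p
    using that partition_onD1[OF P(1)] by auto
  have sub: "R \<subseteq> diagram lam" if "R \<in> P" for R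
    using that partition_onD1[OF P(1)] by auto
  have unique: "R = R'" if "R \<in> P" "R' \<in> P" "p \<in> R" "p \<in> R'" for R R' p
    using that partition_onD2[OF P(1)] by (auto simp: disjoint_def)
  have inj: "p = q" if "R \<in> P" "p \<in> R" "q \<in> R" "fst p = fst q" for R p q
    using P(2)[OF that(1)] inj_onD[of fst R p q] that(2-4) by (simp add: is_ribbon_def)
  have mem: "cell x i \<in> diagram lam" "cell (x + 1) i \<in> diagram lam"
    using less.prems green_size[OF x] cell_in_diagram[OF lam] by auto
  show ?case
  proof (cases "x \<ge> 0")
    case True
    obtain R where R: "R \<in> P" "cell x i \<in> R" using tile mem(1) by blast
    then have "x + 1 \<in> fst ` R" using tile_crosses_green[OF P x R(1)] by force
    then obtain q where q: "q \<in> R" "fst q = x + 1" by force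
    obtain i' where i': "q = cell (x + 1) i'" using q sub[OF R(1)] diagram_memE by (metis subsetD)
    have "\<bar>snd (cell x i) - snd q\<bar> = 1"
      using ribbon_adjacent[OF P(2)[OF R(1)] R(2) q(1)] q(2) by simp
    then have "i' = i \<or> i = Suc i'" using True by (auto simp: i' cell_def)
    moreover have "i \<noteq> Suc i'"
    proof
      assume s: "i = Suc i'"
      then obtain R' where R': "R' \<in> P" "cell x i' \<in> R'" "cell (x + 1) i' \<in> R'"
        using less.IH[of i'] less.prems by auto
      then have "R' = R" using unique[of R' R q] R(1) q(1) i' by blast
      then have "cell x i' = cell x i" using inj[of R "cell x i'" "cell x i"] R R' by simp
      then show False using s by simp
    qed
    ultimately show ?thesis using R q i' by blast
  next
    case False
    obtain R where R: "R \<in> P" "cell (x + 1) i \<in> R" using tile mem(2) by blast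
    then have "x \<in> fst ` R" using tile_crosses_green[OF P x R(1)] by force
    then obtain q where q: "q \<in> R" "fst q = x" by force
    obtain i' where i': "q = cell x i'" using q sub[OF R(1)] diagram_memE by (metis subsetD)
    have "\<bar>snd q - snd (cell (x + 1) i)\<bar> = 1"
      using ribbon_adjacent[OF P(2)[OF R(1)] q(1) R(2)] q(2) by simp
    then have "i' = i \<or> i = Suc i'" using False by (auto simp: i' cell_def)
    moreover have "i \<noteq> Suc i'"
    proof
      assume s: "i = Suc i'"
      then obtain R' where R': "R' \<in> P" "cell x i' \<in> R'" "cell (x + 1) i' \<in> R'"
        using less.IH[of i'] less.prems by auto
      then have "R' = R" using unique[of R' R q] R(1) q(1) i' by blast
      then have "cell (x + 1) i' = cell (x + 1) i"
        using inj[of R "cell (x + 1) i'" "cell (x + 1) i"] R R' by simp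
      then show False using s by simp
    qed
    ultimately show ?thesis using R q i' by blast
  qed
qed

text \<open>Two different boxes of the diagram with the same contraction are a pair across a green strip, so
  tiles are unions of fibres. This makes contraction injective on tilings and keeps
  the contracted tiles disjoint.\<close>

lemma tile_saturated:
  assumes P: "partition_on (diagram lam) P" "\<And>R. R \<in> P \<Longrightarrow> is_ribbon k R"
    and R: "R \<in> P" and p: "p \<in> R" and q: "q \<in> diagram lam"
    and eq: "contract_cell k j p = contract_cell k j q"
  shows "q \<in> R"
proof -
  have unique: "R = R'" if "R \<in> P" "R' \<in> P" "p \<in> R" "p \<in> R'" for R R' p
    using that partition_onD2[OF P(1)] by (auto simp: disjoint_def)
  have pD: "p \<in> diagram lam" using R p partition_onD1[OF P(1)] by auto
  obtain a i where a: "p = cell a i" using pD diagram_memE by blast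
  obtain b i' where b: "q = cell b i'" using q diagram_memE by blast
  have ab: "contract k j a = contract k j b" "i' = i" using eq a b by auto
  have i: "i < column_size lam a" "i < column_size lam b"
    using pD q a b ab(2) cell_in_diagram[OF lam] by auto
  consider "a = b" | "a < b" | "b < a" by linarith
  then show ?thesis
  proof cases
    case 1
    then show ?thesis using p a b ab by simp
  next
    case 2
    have g: "b = a + 1" "a mod int k = int j" using contract_eq_cases[OF k2 jk ab(1) 2] by auto
    obtain R' where "R' \<in> P" "cell a i \<in> R'" "cell (a + 1) i \<in> R'"
      using green_neighbours_same_tile[OF P g(2) i(1)] by blast
    moreover from this have "R' = R" using unique[of R' R p] R p a by simp
    ultimately show ?thesis using b ab(2) g(1) by simp
  next
    case 3
    have g: "a = b + 1" "b mod int k = int j" using contract_eq_cases[OF k2 jk ab(1)[symmetric] 3] by auto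
    obtain R' where "R' \<in> P" "cell b i \<in> R'" "cell (b + 1) i \<in> R'"
      using green_neighbours_same_tile[OF P g(2) i(2)] by blast
    moreover from this have "R' = R" using unique[of R' R p] R p a g(1) by simp
    ultimately show ?thesis using b ab(2) by simp
  qed
qed

lemma tile_seam_closed:
  assumes P: "partition_on (diagram lam) P" "\<And>R. R \<in> P \<Longrightarrow> is_ribbon k R" and R: "R \<in> P"
  shows "seam_closed k j R"
  unfolding seam_closed_def
proof (intro conjI ballI impI)
  fix p assume p: "p \<in> R" "fst p mod int k = int j"
  have pD: "p \<in> diagram lam" using R p partition_onD1[OF P(1)] by auto
  have "contract k j (fst p + 1) = fst (contract_cell k j p)"
    using contract_step[OF k2 jk, of "fst p"] p(2) by simp
  then obtain q where "q \<in> diagram lam" "fst q = fst p + 1" "contract_cell k j q = contract_cell k j p"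
    using contract_mem_ex[OF contract_mem[OF pD]] by blast
  then show "\<exists>q\<in>R. fst q = fst p + 1 \<and> contract_cell k j q = contract_cell k j p"
    using tile_saturated[OF P R p(1), of q] by auto
next
  fix p assume p: "p \<in> R" "(fst p - 1) mod int k = int j"
  have pD: "p \<in> diagram lam" using R p partition_onD1[OF P(1)] by auto
  have "contract k j (fst p - 1) = fst (contract_cell k j p)"
    using contract_step[OF k2 jk, of "fst p - 1"] p(2) by simp
  then obtain q where "q \<in> diagram lam" "fst q = fst p - 1" "contract_cell k j q = contract_cell k j p"
    using contract_mem_ex[OF contract_mem[OF pD]] by blast
  then show "\<exists>q\<in>R. fst q = fst p - 1 \<and> contract_cell k j q = contract_cell k j p"
    using tile_saturated[OF P R p(1), of q] by auto
qed

section \<open>The bijection on tilings\<close>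

lemma expand_contract_cell:
  assumes "partition_on (diagram lam) P" "\<And>R. R \<in> P \<Longrightarrow> is_ribbon k R" "R \<in> P"
  shows "expand (contract_cell k j ` R) = R"
proof
  show "expand (contract_cell k j ` R) \<subseteq> R"
  proof
    fix q assume "q \<in> expand (contract_cell k j ` R)"
    then obtain p where "p \<in> R" "q \<in> diagram lam" "contract_cell k j p = contract_cell k j q"
      unfolding expand_def by auto
    then show "q \<in> R" using tile_saturated[OF assms] by blast
  qed
  show "R \<subseteq> expand (contract_cell k j ` R)"
    using partition_onD1[OF assms(1)] assms(3) by (auto simp: expand_def)
qed

lemma contract_tiling:
  assumes P: "partition_on (diagram lam) P" "\<And>R. R \<in> P \<Longrightarrow> is_ribbon k R"
  shows "partition_on (diagram rho) ((`) (contract_cell k j) ` P)"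
proof (rule partition_onI)
  show "\<Union> ((`) (contract_cell k j) ` P) = diagram rho"
  proof -
    have "\<Union> ((`) (contract_cell k j) ` P) = contract_cell k j ` \<Union> P" by blast
    also have "\<dots> = diagram rho" using contract_image partition_onD1[OF P(1)] by simp
    finally show ?thesis .
  qed
next
  fix S S' assume "S \<in> (`) (contract_cell k j) ` P" "S' \<in> (`) (contract_cell k j) ` P" "S \<noteq> S'"
  then obtain R R' where R: "R \<in> P" "S = contract_cell k j ` R" "R' \<in> P" "S' = contract_cell k j ` R'"
    "R \<noteq> R'" by auto
  show "disjnt S S'"
    unfolding disjnt_iff
  proof (intro allI notI)
    fix s assume "s \<in> S \<and> s \<in> S'"
    then obtain p q where pq: "p \<in> R" "q \<in> R'" "contract_cell k j p = contract_cell k j q"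
      unfolding R(2,4) by auto
    moreover have "q \<in> diagram lam" using pq R partition_onD1[OF P(1)] by auto
    ultimately have "q \<in> R" using tile_saturated[OF P R(1)] by blast
    then have "q \<in> R \<inter> R'" using pq(2) by simp
    moreover have "R \<inter> R' = {}"
      using partition_onD2[OF P(1)] R(1,3,5) by (simp add: disjoint_def)
    ultimately show False by simp
  qed
next
  show "{} \<notin> (`) (contract_cell k j) ` P" using partition_onD3[OF P(1)] by auto
qed

lemma expand_tiling:
  assumes "partition_on (diagram rho) P"
  shows "partition_on (diagram lam) (expand ` P)"
proof (rule partition_onI)
  have "\<Union> (expand ` P) = {p \<in> diagram lam. contract_cell k j p \<in> \<Union> P}"
    by (auto simp: expand_def)
  also have "\<dots> = diagram lam"
    unfolding partition_onD1[OF assms, symmetric] using contract_mem by blast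
  finally show "\<Union> (expand ` P) = diagram lam" .
next
  fix S S' assume "S \<in> expand ` P" "S' \<in> expand ` P" "S \<noteq> S'"
  then obtain R R' where R: "R \<in> P" "S = expand R" "R' \<in> P" "S' = expand R'" "R \<noteq> R'"
    by blast
  then have "R \<inter> R' = {}" using partition_onD2[OF assms] by (simp add: disjoint_def)
  then show "disjnt S S'" unfolding R(2,4) disjnt_def expand_def by blast
next
  have "expand R \<noteq> {}" if "R \<in> P" for R
  proof -
    have "R \<subseteq> diagram rho" "R \<noteq> {}"
      using that partition_onD1[OF assms] partition_onD3[OF assms] by auto
    then show ?thesis using contract_cell_expand[of R] by (metis image_empty)
  qed
  then show "{} \<notin> expand ` P" by auto
qed

lemma Compress_tiling:
  assumes P: "partition_on (diagram lam) P" "\<And>R. R \<in> P \<Longrightarrow> is_ribbon k R"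
  shows "Compress k j (region ` P) = region ` (`) (contract_cell k j) ` P"
proof -
  have "compressed_tile k j (region R) = region (contract_cell k j ` R)" if "R \<in> P" for R
    using compressed_tile_region[OF k2 jk _ tile_seam_closed[OF P that]] P(2)[OF that]
    by (simp add: is_ribbon_def)
  then show ?thesis by (simp add: Compress_def image_image)
qed

lemma bij_betw_Compress:
  "bij_betw (Compress k j) (ribbon_tilings k (diagram lam)) (ribbon_tilings (k - 1) (diagram rho))"
proof (rule bij_betw_imageI)
  show "inj_on (Compress k j) (ribbon_tilings k (diagram lam))"
  proof (rule inj_onI)
    fix t t' assume "t \<in> ribbon_tilings k (diagram lam)" "t' \<in> ribbon_tilings k (diagram lam)"
      and eq: "Compress k j t = Compress k j t'"
    then obtain P P' where P: "t = region ` P" "partition_on (diagram lam) P" "\<And>R. R \<in> P \<Longrightarrow> is_ribbon k R"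
      and P': "t' = region ` P'" "partition_on (diagram lam) P'" "\<And>R. R \<in> P' \<Longrightarrow> is_ribbon k R"
      by (auto simp: ribbon_tilings_def)
    let ?C = "(`) (contract_cell k j)"
    have inj: "inj_on region (Pow cells)" by (intro inj_onI region_inj) auto
    have "\<Union> (?C ` P) \<subseteq> cells" "\<Union> (?C ` P') \<subseteq> cells"
      using partition_onD1[OF contract_tiling[OF P(2,3)]] partition_onD1[OF contract_tiling[OF P'(2,3)]]
        diagram_subset_cells[of rho] by simp_all
    then have sub: "?C ` P \<subseteq> Pow cells" "?C ` P' \<subseteq> Pow cells" by blast+
    have "region ` ?C ` P = region ` ?C ` P'"
      using eq Compress_tiling[OF P(2,3)] Compress_tiling[OF P'(2,3)] P(1) P'(1) by simp
    then have "?C ` P = ?C ` P'" unfolding inj_on_image_eq_iff[OF inj sub] .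
    then have "expand ` ?C ` P = expand ` ?C ` P'" by simp
    moreover have "expand ` ?C ` P = P"
      using expand_contract_cell[OF P(2,3)] by (simp add: image_image cong: image_cong)
    moreover have "expand ` ?C ` P' = P'"
      using expand_contract_cell[OF P'(2,3)] by (simp add: image_image cong: image_cong)
    ultimately show "t = t'" using P(1) P'(1) by simp
  qed
  show "Compress k j ` ribbon_tilings k (diagram lam) = ribbon_tilings (k - 1) (diagram rho)"
  proof
    show "Compress k j ` ribbon_tilings k (diagram lam) \<subseteq> ribbon_tilings (k - 1) (diagram rho)"
    proof
      fix s assume "s \<in> Compress k j ` ribbon_tilings k (diagram lam)"
      then obtain P where P: "s = Compress k j (region ` P)" "partition_on (diagram lam) P"
        "\<And>R. R \<in> P \<Longrightarrow> is_ribbon k R"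
        by (auto simp: ribbon_tilings_def)
      have "is_ribbon (k - 1) (contract_cell k j ` R)" if "R \<in> P" for R
      proof (rule contract_ribbon[OF P(3)[OF that] _ tile_seam_closed[OF P(2,3) that]])
        show "R \<subseteq> diagram lam" using that partition_onD1[OF P(2)] by blast
      qed
      then have ribbons: "\<forall>S\<in>(`) (contract_cell k j) ` P. is_ribbon (k - 1) S" by blast
      have part: "partition_on (diagram rho) ((`) (contract_cell k j) ` P)"
        by (rule contract_tiling[OF P(2,3)])
      have compress: "Compress k j (region ` P) = region ` (`) (contract_cell k j) ` P"
        by (rule Compress_tiling[OF P(2,3)])
      show "s \<in> ribbon_tilings (k - 1) (diagram rho)"
        unfolding ribbon_tilings_def P(1) compress using part ribbons by blast
    qed
    show "ribbon_tilings (k - 1) (diagram rho) \<subseteq> Compress k j ` ribbon_tilings k (diagram lam)"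
    proof
      fix s assume "s \<in> ribbon_tilings (k - 1) (diagram rho)"
      then obtain P where P: "s = region ` P" "partition_on (diagram rho) P"
        "\<And>R. R \<in> P \<Longrightarrow> is_ribbon (k - 1) R"
        by (auto simp: ribbon_tilings_def)
      have sub: "R \<subseteq> diagram rho" if "R \<in> P" for R using that partition_onD1[OF P(2)] by auto
      have part: "partition_on (diagram lam) (expand ` P)" using expand_tiling[OF P(2)] .
      have rib: "is_ribbon k S" if S: "S \<in> expand ` P" for S
      proof -
        obtain R where "R \<in> P" "S = expand R" using S by blast
        then show ?thesis using expand_ribbon[OF P(3) sub] by simp
      qed
      have "(`) (contract_cell k j) ` expand ` P = P"
        using contract_cell_expand[OF sub] by (simp add: image_image cong: image_cong)
      then have "s = Compress k j (region ` expand ` P)"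
        using Compress_tiling[OF part rib] P(1) by simp
      moreover have "region ` expand ` P \<in> ribbon_tilings k (diagram lam)"
        unfolding ribbon_tilings_def using part rib by blast
      ultimately show "s \<in> Compress k j ` ribbon_tilings k (diagram lam)" by blast
    qed
  qed
qed

end

theorem mainTheorem4:
  fixes k j :: nat
    and lam rho :: "nat \<Rightarrow> nat"
    and Q :: "nat \<Rightarrow> nat \<Rightarrow> nat"
  assumes "k \<ge> 2" and "j < k"
    and "is_partition lam"
    and "is_core k lam empty_partition"
    and "is_quotient k lam Q"
    and "Q j = empty_partition"
    and "is_partition rho"
    and "is_core (k - 1) rho empty_partition"
    and "is_quotient (k - 1) rho (\<lambda>i. if i < j then Q i else Q (i + 1))"
  shows "bij_betw (Compress k j)
           (ribbon_tilings k (diagram lam)) (ribbon_tilings (k - 1) (diagram rho))"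
  using assms column_size_contract[OF assms] by (intro bij_betw_Compress)

end
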